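(* Let $(X_i,Y_i)$, $i\ge1$, be i.i.d. bivariate random variables with joint distribution $F_{12}$ and marginals $F_1$ (of $X_i$) and $F_2$ (of $Y_i$), where $X_1$ and $Y_1$ have finite variances, and suppose $\mathbb{E}[X_1^2Y_1^2]<\infty$. Let $\kappa=\kappa(X_1,Y_1)$ be Bergsma's covariance and let $\kappa^*,\tilde\kappa,\hat\kappa$ be its three estimators based on $(X_1,Y_1),\dots,(X_n,Y_n)$. Then, as $n\to\infty$, each of $n^{1/2}(\kappa^*-\kappa)$, $n^{1/2}(\tilde\kappa-\kappa)$ and $n^{1/2}(\hat\kappa-\kappa)$ is asymptotically normal with mean $0$ and variance $\delta_1$, i.e. converges in distribution to $N(0,\delta_1)$ (the point mass at $0$ if $\delta_1=0$), where $$\delta_1=\frac14\,\mathrm{Var}\Big(g_{F_{12}}(X_1,Y_1)+\mu_1g_{F_2}(Y_1)+\mu_2g_{F_1}(X_1)-\mathbb{E}\big[|X_2-X_1|\,|Y_2-Y_3|\,\big|\,X_1\big]-\mathbb{E}\big[|X_2-X_3|\,|Y_2-Y_1|\,\big|\,Y_1\big]-g_{F_1}(X_1)g_{F_2}(Y_1)\Big).$$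
   Context: For a distribution function $F$ on $\mathbb{R}$ with finite mean, with $Z,Z_1,Z_2$ i.i.d. $F$: $g_F(z)=\mathbb{E}|z-Z|$, $g(F)=\mathbb{E}|Z_1-Z_2|$, $h_F(z_1,z_2)=-\tfrac12[|z_1-z_2|-g_F(z_1)-g_F(z_2)+g(F)]$. Bergsma's covariance is $\kappa=\mathbb{E}[h_{F_1}(X_1,X_2)h_{F_2}(Y_1,Y_2)]$. Also $g_{F_{12}}(x,y)=\mathbb{E}[|x-X_1|\,|y-Y_1|]$, $\mu_1=g(F_1)$, $\mu_2=g(F_2)$. Estimators, for a sample $(x_i,y_i)$, $1\le i\le n$, $n\ge3$. Put $A_1(x_i)=\frac1n\sum_k|x_i-x_k|$, $A_2(y_i)=\frac1n\sum_k|y_i-y_k|$, $B_1=\frac1n\sum_iA_1(x_i)$, $B_2=\frac1n\sum_iA_2(y_i)$. (a) $h_{\hat F_1}(x_i,x_j)=-\frac12(|x_i-x_j|-A_1(x_i)-A_1(x_j)+B_1)$, $h_{\hat F_2}(y_i,y_j)=-\frac12(|y_i-y_j|-A_2(y_i)-A_2(y_j)+B_2)$, $\hat\kappa=\frac1{n^2}\sum_{i,j=1}^nh_{\hat F_1}(x_i,x_j)h_{\hat F_2}(y_i,y_j)$. (b) $\tilde h_{\hat F_1}(x_i,x_j)=-\frac12(|x_i-x_j|-\frac n{n-1}A_1(x_i)-\frac n{n-1}A_1(x_j)+\frac n{n-1}B_1)$, $\tilde h_{\hat F_2}(y_i,y_j)=-\frac12(|y_i-y_j|-\frac n{n-1}A_2(y_i)-\frac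 n{n-1}A_2(y_j)+\frac n{n-1}B_2)$, $\tilde\kappa=\binom n2^{-1}\sum_{i<j}\tilde h_{\hat F_1}(x_i,x_j)\tilde h_{\hat F_2}(y_i,y_j)$. (c) $U_{1n}=\binom n2^{-1}\sum_{i<j}|x_i-x_j|$, $U_{2n}=\binom n2^{-1}\sum_{i<j}|y_i-y_j|$, $U_{12n}=\binom n2^{-1}\sum_{i<j}|x_i-x_j||y_i-y_j|$, $U_{3n}=\binom n3^{-1}\sum_{i<j<k}h((x_i,y_i),(x_j,y_j),(x_k,y_k))$ with $$h\big((x_1,y_1),(x_2,y_2),(x_3,y_3)\big)=\tfrac16\big[|x_1-x_2||y_1-y_3|+|x_2-x_1||y_2-y_3|+|x_1-x_3||y_1-y_2|+|x_2-x_3||y_2-y_1|+|x_3-x_1||y_3-y_2|+|x_3-x_2||y_3-y_1|\big],$$ and $\kappa^*=\frac14[U_{12n}+U_{1n}U_{2n}-2U_{3n}]$. *)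

theory Defs
  imports "HOL-Probability.Probability"
begin

text \<open>Distribution functions are represented by the corresponding laws: Borel probability measures
  on the real line for marginals, on pairs of reals for joint distributions. An expectation over
  independent copies is an integral over a product measure.\<close>

definition g_at :: "real measure \<Rightarrow> real \<Rightarrow> real" where
  "g_at F z = (\<integral>t. \<bar>z - t\<bar> \<partial>F)"

definition g_mean :: "real measure \<Rightarrow> real" where
  "g_mean F = (\<integral>(z1, z2). \<bar>z1 - z2\<bar> \<partial>(F \<Otimes>\<^sub>M F))"

definition h_fun :: "real measure \<Rightarrow> real \<Rightarrow> real \<Rightarrow> real" where
  "h_fun F z1 z2 = - (1/2) * (\<bar>z1 - z2\<bar> - g_at F z1 - g_at F z2 + g_mean F)"

definition g_joint :: "(real \<times> real) measure \<Rightarrow> real \<Rightarrow> real \<Rightarrow> real" where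
  "g_joint F12 x y = (\<integral>(u, v). \<bar>x - u\<bar> * \<bar>y - v\<bar> \<partial>F12)"

definition marginal1 :: "(real \<times> real) measure \<Rightarrow> real measure" where
  "marginal1 F12 = distr F12 borel fst"

definition marginal2 :: "(real \<times> real) measure \<Rightarrow> real measure" where
  "marginal2 F12 = distr F12 borel snd"

definition bergsma_cov :: "(real \<times> real) measure \<Rightarrow> real" where
  "bergsma_cov F12 =
     (\<integral>((x1, y1), (x2, y2)). h_fun (marginal1 F12) x1 x2 * h_fun (marginal2 F12) y1 y2
        \<partial>(F12 \<Otimes>\<^sub>M F12))"

text \<open>A sample of size \<open>n\<close> is given by sequences \<open>x\<close>, \<open>y\<close>, of which only the entries with
  indices \<open>1, \<dots>, n\<close> are used.\<close>

definition A_emp :: "nat \<Rightarrow> (nat \<Rightarrow> real) \<Rightarrow> nat \<Rightarrow> real" where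
  "A_emp n x i = 1 / real n * (\<Sum>k=1..n. \<bar>x i - x k\<bar>)"

definition B_emp :: "nat \<Rightarrow> (nat \<Rightarrow> real) \<Rightarrow> real" where
  "B_emp n x = 1 / real n * (\<Sum>i=1..n. A_emp n x i)"

definition h_hat :: "nat \<Rightarrow> (nat \<Rightarrow> real) \<Rightarrow> nat \<Rightarrow> nat \<Rightarrow> real" where
  "h_hat n x i j = - (1/2) * (\<bar>x i - x j\<bar> - A_emp n x i - A_emp n x j + B_emp n x)"

definition kappa_hat :: "nat \<Rightarrow> (nat \<Rightarrow> real) \<Rightarrow> (nat \<Rightarrow> real) \<Rightarrow> real" where
  "kappa_hat n x y = 1 / (real n)\<^sup>2 * (\<Sum>i=1..n. \<Sum>j=1..n. h_hat n x i j * h_hat n y i j)"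

definition h_tilde :: "nat \<Rightarrow> (nat \<Rightarrow> real) \<Rightarrow> nat \<Rightarrow> nat \<Rightarrow> real" where
  "h_tilde n x i j = - (1/2) * (\<bar>x i - x j\<bar>
     - real n / (real n - 1) * A_emp n x i - real n / (real n - 1) * A_emp n x j
     + real n / (real n - 1) * B_emp n x)"

definition kappa_tilde :: "nat \<Rightarrow> (nat \<Rightarrow> real) \<Rightarrow> (nat \<Rightarrow> real) \<Rightarrow> real" where
  "kappa_tilde n x y = 1 / real (n choose 2) *
     (\<Sum>i=1..n. \<Sum>j\<in>{i<..n}. h_tilde n x i j * h_tilde n y i j)"

definition U1 :: "nat \<Rightarrow> (nat \<Rightarrow> real) \<Rightarrow> real" where
  "U1 n x = 1 / real (n choose 2) * (\<Sum>i=1..n. \<Sum>j\<in>{i<..n}. \<bar>x i - x j\<bar>)"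

definition U12 :: "nat \<Rightarrow> (nat \<Rightarrow> real) \<Rightarrow> (nat \<Rightarrow> real) \<Rightarrow> real" where
  "U12 n x y = 1 / real (n choose 2) *
     (\<Sum>i=1..n. \<Sum>j\<in>{i<..n}. \<bar>x i - x j\<bar> * \<bar>y i - y j\<bar>)"

fun h_kernel :: "real \<times> real \<Rightarrow> real \<times> real \<Rightarrow> real \<times> real \<Rightarrow> real" where
  "h_kernel (x1, y1) (x2, y2) (x3, y3) = 1/6 *
     (\<bar>x1 - x2\<bar> * \<bar>y1 - y3\<bar> + \<bar>x2 - x1\<bar> * \<bar>y2 - y3\<bar> + \<bar>x1 - x3\<bar> * \<bar>y1 - y2\<bar>
    + \<bar>x2 - x3\<bar> * \<bar>y2 - y1\<bar> + \<bar>x3 - x1\<bar> * \<bar>y3 - y2\<bar> + \<bar>x3 - x2\<bar> * \<bar>y3 - y1\<bar>)"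

definition U3 :: "nat \<Rightarrow> (nat \<Rightarrow> real) \<Rightarrow> (nat \<Rightarrow> real) \<Rightarrow> real" where
  "U3 n x y = 1 / real (n choose 3) *
     (\<Sum>i=1..n. \<Sum>j\<in>{i<..n}. \<Sum>k\<in>{j<..n}. h_kernel (x i, y i) (x j, y j) (x k, y k))"

definition kappa_star :: "nat \<Rightarrow> (nat \<Rightarrow> real) \<Rightarrow> (nat \<Rightarrow> real) \<Rightarrow> real" where
  "kappa_star n x y = 1/4 * (U12 n x y + U1 n x * U1 n y - 2 * U3 n x y)"

text \<open>The case split is needed because \<open>normal_density m 0\<close> is not the density of a point mass.\<close>

definition normal_law :: "real \<Rightarrow> real \<Rightarrow> real measure" where
  "normal_law m v =
     (if v = 0 then return borel m else density lborel (normal_density m (sqrt v)))"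

text \<open>The sigma-algebra generated by a real random variable.\<close>

definition sigma_rv :: "'a measure \<Rightarrow> ('a \<Rightarrow> real) \<Rightarrow> 'a measure" where
  "sigma_rv M Z = vimage_algebra (space M) Z borel"

end

theory Submission
  imports Defs "HOL-Real_Asymp.Real_Asymp"
begin

text \<open>
  Let \<open>F\<close> be the joint law, \<open>h\<^sub>1\<close> and \<open>h\<^sub>2\<close> the kernels \<open>h_fun\<close> of its two marginals,
  and \<open>H((x, y), (x', y')) = h\<^sub>1(x, x') h\<^sub>2(y, y')\<close>, so that \<open>\<kappa>\<close> is the mean of \<open>H\<close> under
  \<open>F \<otimes> F\<close>. The theorem is proved first for \<open>kappa_hat\<close> and then transferred.

  The matrix of the \<open>h_hat n x i j\<close> arises from \<open>- \<bar>x i - x j\<bar> / 2\<close> by double centring, and double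
  centring annihilates every matrix of the form \<open>u i + u j\<close>. Hence it also arises from
  \<open>h\<^sub>1(x i, x j)\<close> (\<open>h_hat_eq_h_fun\<close>). Expanding the product of the two doubly centred matrices shows
  that \<open>kappa_hat\<close> is the von Mises statistic \<open>(1/n\<^sup>2) \<Sum>\<^sub>i\<^sub>,\<^sub>j H(Z\<^sub>i, Z\<^sub>j)\<close> up to products of row means
  and of grand means of \<open>h\<^sub>1\<close> and \<open>h\<^sub>2\<close>. Since these kernels integrate to zero in each argument, the
  entries of a row are orthogonal, and the row means are of order \<open>1 / sqrt n\<close> in mean square. The
  products are therefore of order \<open>1/n\<close>, negligible after multiplication by \<open>sqrt n\<close>
  (\<open>khat_close_von_Mises\<close>).

  For the von Mises statistic, Hoeffding's projection onto sums of functions of one observation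
  leaves a degenerate kernel whose double sum has orthogonal terms, hence is again of order \<open>1/n\<close>
  after division by \<open>n\<^sup>2\<close>. What remains is \<open>\<kappa>\<close> plus the average of the independent variables
  \<open>2 (H\<^sub>1(Z\<^sub>i) - \<kappa>)\<close>, where \<open>H\<^sub>1(z) = \<integral> H(z, w) dF(w)\<close>, and the classical central limit theorem
  gives the variance \<open>4 Var H\<^sub>1\<close> (\<open>von_Mises_clt\<close>). Multiplying out \<open>H\<close> identifies \<open>4 H\<^sub>1(Z\<^sub>1)\<close>, up to
  an additive constant, with the variable whose variance defines \<open>\<delta>1\<close>; the two conditional
  expectations are computed by integrating out the observations that do not occur in the condition
  (\<open>proj_eq\<close>, \<open>cond_exp_cross\<close>, \<open>asymptotic_variance\<close>).

  All three estimators are linear combinations of the same three statistics: the mean of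
  \<open>\<bar>x\<^sub>i - x\<^sub>j\<bar> \<bar>y\<^sub>i - y\<^sub>j\<bar>\<close>, the mean of the products of row means, and the product of the grand means.
  Their coefficients differ by \<open>O(1/n)\<close>, and the means of the absolute values of the statistics are
  bounded in \<open>n\<close>, so the estimators are close in mean and hence have the same limit law
  (\<open>estimator_clt\<close>, \<open>weak_conv_m_L1_close\<close>).
\<close>

section \<open>Weak convergence on the real line\<close>

lemma sqrt_mult_divide: "sqrt (real n) * (t / n) = t / sqrt n"
  using real_sqrt_mult_self[of "real n"] by (cases "n = 0") (auto simp: divide_simps)

lemma sqrt_mult_rate_tendsto_0: "(\<lambda>n. sqrt (real n) * (C / n)) \<longlonglongrightarrow> 0"
  unfolding sqrt_mult_divide
  by (intro tendsto_divide_0[OF tendsto_const] filterlim_at_top_imp_at_infinity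
      filterlim_compose[OF sqrt_at_top filterlim_real_sequentially])

lemma real_distribution_normal_law:
  assumes "v \<ge> 0"
  shows "real_distribution (normal_law m v)"
proof (cases "v = 0")
  case True
  have "prob_space (return borel m)" by (rule prob_space_return) simp
  then show ?thesis
    using True by (auto simp: normal_law_def real_distribution_def real_distribution_axioms_def)
next
  case False
  with assms have "prob_space (density lborel (normal_density m (sqrt v)))"
    by (intro prob_space_normal_density) auto
  then show ?thesis
    using False by (auto simp: normal_law_def real_distribution_def real_distribution_axioms_def)
qed

lemma norm_iexp_diff_le: "cmod (iexp a - iexp b) \<le> \<bar>a - b\<bar>" for a b :: real
proof -
  have "iexp a - iexp b = iexp b * (iexp (a - b) - 1)"
    by (simp add: right_diff_distrib flip: exp_add)
  then have "cmod (iexp a - iexp b) = cmod (iexp (a - b) - 1)"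
    by (simp add: norm_mult)
  also have "\<dots> \<le> \<bar>a - b\<bar>"
    using iexp_approx1[of "a - b" 0] by simp
  finally show ?thesis .
qed

text \<open>A form of Slutsky's theorem: closeness in mean makes the characteristic functions close,
  since \<open>u \<mapsto> exp (i t u)\<close> is Lipschitz, and Levy's continuity theorem does the rest.\<close>

lemma (in prob_space) weak_conv_m_L1_close:
  fixes V W :: "nat \<Rightarrow> 'a \<Rightarrow> real"
  assumes V [measurable]: "\<And>n. random_variable borel (V n)"
    and W [measurable]: "\<And>n. random_variable borel (W n)"
    and L: "real_distribution L"
    and conv: "weak_conv_m (\<lambda>n. distr M borel (V n)) L"
    and int: "eventually (\<lambda>n. integrable M (\<lambda>\<omega>. W n \<omega> - V n \<omega>)) sequentially"
    and close: "(\<lambda>n. expectation (\<lambda>\<omega>. \<bar>W n \<omega> - V n \<omega>\<bar>)) \<longlonglongrightarrow> 0"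
  shows "weak_conv_m (\<lambda>n. distr M borel (W n)) L"
proof (rule levy_continuity)
  fix t :: real
  let ?cV = "\<lambda>n. char (distr M borel (V n)) t" and ?cW = "\<lambda>n. char (distr M borel (W n)) t"
  have "cmod (?cW n - ?cV n) \<le> \<bar>t\<bar> * expectation (\<lambda>\<omega>. \<bar>W n \<omega> - V n \<omega>\<bar>)"
    if int_n: "integrable M (\<lambda>\<omega>. W n \<omega> - V n \<omega>)" for n
  proof -
    have iW: "integrable M (\<lambda>\<omega>. iexp (t * W n \<omega>))" and iV: "integrable M (\<lambda>\<omega>. iexp (t * V n \<omega>))"
      by (auto intro!: integrable_iexp)
    have "?cW n - ?cV n = (CLINT \<omega>|M. iexp (t * W n \<omega>) - iexp (t * V n \<omega>))"
      using iW iV by (simp add: char_def integral_distr)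
    also have "cmod \<dots> \<le> expectation (\<lambda>\<omega>. cmod (iexp (t * W n \<omega>) - iexp (t * V n \<omega>)))"
      by (rule integral_norm_bound)
    also have "\<dots> \<le> expectation (\<lambda>\<omega>. \<bar>t\<bar> * \<bar>W n \<omega> - V n \<omega>\<bar>)"
    proof (rule integral_mono)
      show "integrable M (\<lambda>\<omega>. cmod (iexp (t * W n \<omega>) - iexp (t * V n \<omega>)))"
        using iW iV by (intro integrable_norm Bochner_Integration.integrable_diff)
      show "integrable M (\<lambda>\<omega>. \<bar>t\<bar> * \<bar>W n \<omega> - V n \<omega>\<bar>)"
        using int_n by auto
      show "cmod (iexp (t * W n \<omega>) - iexp (t * V n \<omega>)) \<le> \<bar>t\<bar> * \<bar>W n \<omega> - V n \<omega>\<bar>" for \<omega>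
        using norm_iexp_diff_le[of "t * W n \<omega>" "t * V n \<omega>"]
        by (simp add: abs_mult flip: right_diff_distrib)
    qed
    finally show ?thesis by simp
  qed
  then have "eventually (\<lambda>n. cmod (?cW n - ?cV n)
      \<le> \<bar>t\<bar> * expectation (\<lambda>\<omega>. \<bar>W n \<omega> - V n \<omega>\<bar>)) sequentially"
    using int by (rule eventually_mono[rotated])
  then have "(\<lambda>n. ?cW n - ?cV n) \<longlonglongrightarrow> 0"
    by (rule Lim_null_comparison) (use close in \<open>auto intro!: tendsto_eq_intros\<close>)
  moreover have "?cV \<longlonglongrightarrow> char L t"
    by (rule levy_continuity1) (use L conv in auto)
  ultimately show "?cW \<longlonglongrightarrow> char L t"
    using tendsto_add by fastforce
qed (use L in auto)

text \<open>The form in which the previous lemma is used: a difference of \<open>o(1 / sqrt n)\<close> in mean does not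
  affect a limit law at scale \<open>sqrt n\<close>.\<close>

lemma (in prob_space) weak_conv_m_sqrt_close:
  fixes V W :: "nat \<Rightarrow> 'a \<Rightarrow> real"
  assumes [measurable]: "\<And>n. random_variable borel (V n)" "\<And>n. random_variable borel (W n)"
    and L: "real_distribution L"
    and conv: "weak_conv_m (\<lambda>n. distr M borel (\<lambda>\<omega>. sqrt n * (V n \<omega> - \<theta>))) L"
    and close: "\<And>n. n \<ge> n\<^sub>0 \<Longrightarrow>
        integrable M (\<lambda>\<omega>. W n \<omega> - V n \<omega>) \<and> expectation (\<lambda>\<omega>. \<bar>W n \<omega> - V n \<omega>\<bar>) \<le> e n"
    and e: "(\<lambda>n. sqrt n * e n) \<longlonglongrightarrow> 0"
  shows "weak_conv_m (\<lambda>n. distr M borel (\<lambda>\<omega>. sqrt n * (W n \<omega> - \<theta>))) L"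
proof (rule weak_conv_m_L1_close[OF _ _ L conv])
  have diff: "sqrt n * (W n \<omega> - \<theta>) - sqrt n * (V n \<omega> - \<theta>) = sqrt n * (W n \<omega> - V n \<omega>)" for n \<omega>
    by (simp add: algebra_simps)
  show "\<forall>\<^sub>F n in sequentially. integrable M (\<lambda>\<omega>. sqrt n * (W n \<omega> - \<theta>) - sqrt n * (V n \<omega> - \<theta>))"
    unfolding diff using close by (auto intro!: eventually_sequentiallyI[of n\<^sub>0])
  have "\<forall>\<^sub>F n in sequentially.
      norm (expectation (\<lambda>\<omega>. \<bar>sqrt n * (W n \<omega> - \<theta>) - sqrt n * (V n \<omega> - \<theta>)\<bar>)) \<le> sqrt n * e n"
  proof (rule eventually_sequentiallyI[of n\<^sub>0])
    fix n assume n: "n \<ge> n\<^sub>0"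
    show "norm (expectation (\<lambda>\<omega>. \<bar>sqrt n * (W n \<omega> - \<theta>) - sqrt n * (V n \<omega> - \<theta>)\<bar>)) \<le> sqrt n * e n"
      unfolding diff abs_mult
      using close[OF n] mult_left_mono[OF conjunct2[OF close[OF n]], of "sqrt n"] by simp
  qed
  then show "(\<lambda>n. expectation (\<lambda>\<omega>. \<bar>sqrt n * (W n \<omega> - \<theta>) - sqrt n * (V n \<omega> - \<theta>)\<bar>)) \<longlonglongrightarrow> 0"
    using e by (rule Lim_null_comparison)
qed measurable

lemma distr_std_normal_scale:
  assumes "\<sigma> > 0"
  shows "distr std_normal_distribution borel (\<lambda>x. \<sigma> * x) = density lborel (normal_density 0 \<sigma>)"
proof -
  interpret prob_space std_normal_distribution
    using real_dist_normal_dist by (simp add: real_distribution_def)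
  have "distributed std_normal_distribution lborel (\<lambda>x. x) (\<lambda>x. ennreal (std_normal_density x))"
    by (auto simp: distributed_def intro!: measure_eqI simp: emeasure_distr)
  from normal_density_affine[OF this, of \<sigma> 0]
  have "distributed std_normal_distribution lborel (\<lambda>x. \<sigma> * x) (normal_density 0 \<sigma>)"
    using assms by simp
  then show ?thesis
    by (auto simp: distributed_def cong: distr_cong)
qed

lemma weak_conv_m_scale:
  fixes L :: "nat \<Rightarrow> real measure"
  assumes L: "\<And>n. real_distribution (L n)" and L': "real_distribution L'" and "weak_conv_m L L'"
  shows "weak_conv_m (\<lambda>n. distr (L n) borel (\<lambda>x. c * x)) (distr L' borel (\<lambda>x. c * x))"
proof (rule levy_continuity)
  interpret L: real_distribution "L n" for n by fact
  interpret L': real_distribution L' by fact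
  show "real_distribution (distr (L n) borel ((*) c))" for n by simp
  show "real_distribution (distr L' borel ((*) c))" by simp
  have *: "char (distr K borel (\<lambda>x. c * x)) t = char K (t * c)" if "real_distribution K" for K t
  proof -
    interpret real_distribution K by fact
    show ?thesis by (simp add: char_def integral_distr mult.assoc)
  qed
  show "(\<lambda>n. char (distr (L n) borel ((*) c)) t) \<longlonglongrightarrow> char (distr L' borel ((*) c)) t" for t
    using levy_continuity1[OF L L' assms(3), of "t * c"] L L' by (simp add: *)
qed

text \<open>The central limit theorem in a form that includes the degenerate case: for zero variance the
  summands vanish almost surely.\<close>

lemma (in prob_space) clt_normal_law:
  fixes V :: "nat \<Rightarrow> 'a \<Rightarrow> real"
  assumes indep: "indep_vars (\<lambda>_. borel) V UNIV"
    and mean: "\<And>n. expectation (V n) = 0"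
    and sq: "\<And>n. integrable M (\<lambda>\<omega>. (V n \<omega>)\<^sup>2)"
    and var: "\<And>n. expectation (\<lambda>\<omega>. (V n \<omega>)\<^sup>2) = v"
    and dist: "\<And>n. distr M borel (V n) = \<nu>"
  shows "weak_conv_m (\<lambda>n. distr M borel (\<lambda>\<omega>. (\<Sum>i<n. V i \<omega>) / sqrt n)) (normal_law 0 v)"
proof (cases "v = 0")
  case True
  have [measurable]: "random_variable borel (V n)" for n
    using indep unfolding indep_vars_def2 by simp
  have "AE \<omega> in M. V n \<omega> = 0" for n
    using integral_nonneg_eq_0_iff_AE[OF sq[of n]] var[of n] True by simp
  then have "AE \<omega> in M. \<forall>n. V n \<omega> = 0"
    by (simp add: AE_all_countable)
  then have "distr M borel (\<lambda>\<omega>. (\<Sum>i<n. V i \<omega>) / sqrt n) = distr M borel (\<lambda>\<omega>. 0)" for n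
    by (intro distr_cong_AE) auto
  also have "distr M borel (\<lambda>\<omega>. 0 :: real) = normal_law 0 v"
    using True by (simp add: normal_law_def)
  finally show ?thesis
    by (simp add: weak_conv_m_def weak_conv_def)
next
  case False
  have [measurable]: "random_variable borel (V n)" for n
    using indep unfolding indep_vars_def2 by simp
  have "v \<ge> 0"
    using var[of 0] by (metis integral_nonneg_AE AE_I2 zero_le_power2)
  with False have v: "v > 0" by simp
  let ?L = "\<lambda>n. distr M borel (\<lambda>\<omega>. (\<Sum>i<n. V i \<omega>) / sqrt (real n * (sqrt v)\<^sup>2))"
  have "weak_conv_m ?L std_normal_distribution"
    using v by (intro central_limit_theorem_zero_mean[OF indep mean _ sq _ dist])
      (auto simp: mean var)
  then have "weak_conv_m (\<lambda>n. distr (?L n) borel (\<lambda>x. sqrt v * x))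
      (distr std_normal_distribution borel (\<lambda>x. sqrt v * x))"
    by (intro weak_conv_m_scale) (auto simp: real_dist_normal_dist)
  also have "distr std_normal_distribution borel (\<lambda>x. sqrt v * x) = normal_law 0 v"
    using v by (subst distr_std_normal_scale) (auto simp: normal_law_def)
  also have "(\<lambda>n. distr (?L n) borel (\<lambda>x. sqrt v * x))
      = (\<lambda>n. distr M borel (\<lambda>\<omega>. (\<Sum>i<n. V i \<omega>) / sqrt n))"
    using v by (simp add: distr_distr comp_def real_sqrt_mult)
  finally show ?thesis .
qed

section \<open>Algebra of doubly centred matrices\<close>

definition row_mean :: "nat \<Rightarrow> (nat \<Rightarrow> nat \<Rightarrow> real) \<Rightarrow> nat \<Rightarrow> real" where
  "row_mean n a i = (\<Sum>k=1..n. a i k) / n"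

definition grand_mean :: "nat \<Rightarrow> (nat \<Rightarrow> nat \<Rightarrow> real) \<Rightarrow> real" where
  "grand_mean n a = (\<Sum>i=1..n. row_mean n a i) / n"

text \<open>For \<open>c = 1\<close> this is double centring, as in \<open>kappa_hat\<close>; \<open>kappa_tilde\<close> has \<open>c = n / (n - 1)\<close>.\<close>

definition centred :: "real \<Rightarrow> nat \<Rightarrow> (nat \<Rightarrow> nat \<Rightarrow> real) \<Rightarrow> nat \<Rightarrow> nat \<Rightarrow> real" where
  "centred c n a i j = a i j - c * row_mean n a i - c * row_mean n a j + c * grand_mean n a"

definition mean_prod :: "nat \<Rightarrow> (nat \<Rightarrow> nat \<Rightarrow> real) \<Rightarrow> (nat \<Rightarrow> nat \<Rightarrow> real) \<Rightarrow> real" where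
  "mean_prod n a b = (\<Sum>i=1..n. \<Sum>j=1..n. a i j * b i j) / (real n)\<^sup>2"

definition row_mean_prod :: "nat \<Rightarrow> (nat \<Rightarrow> nat \<Rightarrow> real) \<Rightarrow> (nat \<Rightarrow> nat \<Rightarrow> real) \<Rightarrow> real" where
  "row_mean_prod n a b = (\<Sum>i=1..n. row_mean n a i * row_mean n b i) / n"

lemma sum_symmetric_split:
  fixes f :: "nat \<Rightarrow> nat \<Rightarrow> real"
  assumes "\<And>i j. f i j = f j i"
  shows "(\<Sum>i=1..n. \<Sum>j=1..n. f i j)
    = 2 * (\<Sum>i=1..n. \<Sum>j\<in>{i<..n}. f i j) + (\<Sum>i=1..n. f i i)"
proof -
  have "(\<Sum>i=1..n. \<Sum>j=1..n. f i j)
      = (\<Sum>i=1..n. (\<Sum>j\<in>{i<..n}. f i j) + (\<Sum>j\<in>{1..<i}. f i j) + f i i)"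
  proof (intro sum.cong refl)
    fix i assume "i \<in> {1..n}"
    then have "{1..n} = insert i ({i<..n} \<union> {1..<i})" by auto
    moreover have "{i<..n} \<inter> {1..<i} = {}" by auto
    ultimately show "(\<Sum>j=1..n. f i j) = (\<Sum>j\<in>{i<..n}. f i j) + (\<Sum>j\<in>{1..<i}. f i j) + f i i"
      by (simp add: sum.union_disjoint)
  qed
  moreover have "(\<Sum>i=1..n. \<Sum>j\<in>{1..<i}. f i j) = (\<Sum>j=1..n. \<Sum>i\<in>{j<..n}. f i j)"
    unfolding sum.Sigma[OF finite_atLeastAtMost ballI[OF finite_atLeastLessThan]]
      sum.Sigma[OF finite_atLeastAtMost ballI[OF finite_greaterThanAtMost]]
    by (rule sum.reindex_bij_witness[of _ "\<lambda>(i, j). (j, i)" "\<lambda>(i, j). (j, i)"]) auto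
  ultimately show ?thesis
    using assms by (simp add: sum.distrib)
qed

lemma sum_prod_minus_margins:
  fixes a b :: "nat \<Rightarrow> nat \<Rightarrow> real"
  assumes a: "\<And>i j. a i j = a j i" and b: "\<And>i j. b i j = b j i"
  shows "(\<Sum>i=1..n. \<Sum>j=1..n. (a i j - u i - u j) * (b i j - v i - v j))
    = (\<Sum>i=1..n. \<Sum>j=1..n. a i j * b i j)
      - 2 * (\<Sum>i=1..n. v i * (\<Sum>j=1..n. a i j)) - 2 * (\<Sum>i=1..n. u i * (\<Sum>j=1..n. b i j))
      + 2 * real n * (\<Sum>i=1..n. u i * v i) + 2 * (\<Sum>i=1..n. u i) * (\<Sum>i=1..n. v i)"
proof -
  have swap: "(\<Sum>i=1..n. \<Sum>j=1..n. w j * d i j) = (\<Sum>i=1..n. w i * (\<Sum>j=1..n. d i j))"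
    if "\<And>i j. d i j = d j i" for w :: "nat \<Rightarrow> real" and d :: "nat \<Rightarrow> nat \<Rightarrow> real"
  proof -
    have "(\<Sum>i=1..n. \<Sum>j=1..n. w j * d i j) = (\<Sum>j=1..n. \<Sum>i=1..n. w j * d j i)"
      by (subst sum.swap) (simp add: that)
    then show ?thesis by (simp add: sum_distrib_left)
  qed
  have "(\<Sum>i=1..n. \<Sum>j=1..n. (a i j - u i - u j) * (b i j - v i - v j))
      = (\<Sum>i=1..n. \<Sum>j=1..n. a i j * b i j - v i * a i j - v j * a i j - u i * b i j - u j * b i j
          + (u i * v i + u j * v j) + (u i * v j + v i * u j))"
    by (intro sum.cong refl) (simp add: algebra_simps)
  also have "\<dots> = (\<Sum>i=1..n. \<Sum>j=1..n. a i j * b i j) - (\<Sum>i=1..n. \<Sum>j=1..n. v i * a i j)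
      - (\<Sum>i=1..n. \<Sum>j=1..n. v j * a i j) - (\<Sum>i=1..n. \<Sum>j=1..n. u i * b i j)
      - (\<Sum>i=1..n. \<Sum>j=1..n. u j * b i j)
      + ((\<Sum>i=1..n. \<Sum>j=1..n. u i * v i) + (\<Sum>i=1..n. \<Sum>j=1..n. u j * v j))
      + ((\<Sum>i=1..n. \<Sum>j=1..n. u i * v j) + (\<Sum>i=1..n. \<Sum>j=1..n. v i * u j))"
    by (simp only: sum.distrib sum_subtractf)
  also have "\<dots> = (\<Sum>i=1..n. \<Sum>j=1..n. a i j * b i j)
      - 2 * (\<Sum>i=1..n. v i * (\<Sum>j=1..n. a i j)) - 2 * (\<Sum>i=1..n. u i * (\<Sum>j=1..n. b i j))
      + 2 * real n * (\<Sum>i=1..n. u i * v i) + 2 * (\<Sum>i=1..n. u i) * (\<Sum>i=1..n. v i)"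
    unfolding swap[of a v, OF a] swap[of b u, OF b]
    by (simp add: sum_distrib_left[symmetric] sum_distrib_right[symmetric])
  finally show ?thesis .
qed

text \<open>The cross terms collapse because a row sum of \<open>a\<close> is \<open>n\<close> times its row mean; the two matrices
  then interact only through their entrywise products, row means and grand means.\<close>

lemma sum_centred_prod:
  fixes a b :: "nat \<Rightarrow> nat \<Rightarrow> real"
  assumes n: "n \<ge> 1" and a: "\<And>i j. a i j = a j i" and b: "\<And>i j. b i j = b j i"
  shows "(\<Sum>i=1..n. \<Sum>j=1..n. centred c n a i j * centred c n b i j)
    = (real n)\<^sup>2 * (mean_prod n a b + (2 * c\<^sup>2 - 4 * c) * row_mean_prod n a b
        + (2 * c - c\<^sup>2) * (grand_mean n a * grand_mean n b))"
proof -
  \<comment> \<open>Half of the grand mean goes to each index, so that the centred entry is \<open>a i j - u i - u j\<close>.\<close>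
  define u where "u i = c * row_mean n a i - c * grand_mean n a / 2" for i
  define v where "v i = c * row_mean n b i - c * grand_mean n b / 2" for i
  have ra: "(\<Sum>j=1..n. a i j) = n * row_mean n a i" and rb: "(\<Sum>j=1..n. b i j) = n * row_mean n b i" for i
    using n by (simp_all add: row_mean_def)
  have ga: "(\<Sum>i=1..n. row_mean n a i) = n * grand_mean n a"
    and gb: "(\<Sum>i=1..n. row_mean n b i) = n * grand_mean n b"
    using n by (simp_all add: grand_mean_def)
  have q: "(\<Sum>i=1..n. row_mean n a i * row_mean n b i) = n * row_mean_prod n a b"
    using n by (simp add: row_mean_prod_def)
  have p: "(\<Sum>i=1..n. \<Sum>j=1..n. a i j * b i j) = (real n)\<^sup>2 * mean_prod n a b"
    using n by (simp add: mean_prod_def)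
  have su: "(\<Sum>i=1..n. u i) = c * n * grand_mean n a / 2"
    unfolding u_def sum_subtractf sum_distrib_left[symmetric] ga by (simp add: field_simps)
  have sv: "(\<Sum>i=1..n. v i) = c * n * grand_mean n b / 2"
    unfolding v_def sum_subtractf sum_distrib_left[symmetric] gb by (simp add: field_simps)
  have su': "(\<Sum>i=1..n. u i * row_mean n b i)
      = c * n * row_mean_prod n a b - c * n * (grand_mean n a * grand_mean n b) / 2"
  proof -
    have "(\<Sum>i=1..n. u i * row_mean n b i) = c * (\<Sum>i=1..n. row_mean n a i * row_mean n b i)
        - c * grand_mean n a / 2 * (\<Sum>i=1..n. row_mean n b i)"
      unfolding sum_distrib_left sum_subtractf[symmetric] by (simp add: u_def algebra_simps)
    then show ?thesis unfolding q gb by (simp add: algebra_simps)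
  qed
  have sv': "(\<Sum>i=1..n. v i * row_mean n a i)
      = c * n * row_mean_prod n a b - c * n * (grand_mean n a * grand_mean n b) / 2"
  proof -
    have "(\<Sum>i=1..n. v i * row_mean n a i) = c * (\<Sum>i=1..n. row_mean n a i * row_mean n b i)
        - c * grand_mean n b / 2 * (\<Sum>i=1..n. row_mean n a i)"
      unfolding sum_distrib_left sum_subtractf[symmetric] by (simp add: v_def algebra_simps)
    then show ?thesis unfolding q ga by (simp add: algebra_simps)
  qed
  have suv: "(\<Sum>i=1..n. u i * v i)
      = c\<^sup>2 * n * row_mean_prod n a b - 3/4 * c\<^sup>2 * n * (grand_mean n a * grand_mean n b)"
  proof -
    have "(\<Sum>i=1..n. u i * v i) = c * (\<Sum>i=1..n. u i * row_mean n b i)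
        - c * grand_mean n b / 2 * (\<Sum>i=1..n. u i)"
      unfolding sum_distrib_left sum_subtractf[symmetric] by (simp add: v_def algebra_simps)
    then show ?thesis unfolding su su' by (simp add: power2_eq_square algebra_simps)
  qed
  have "(\<Sum>i=1..n. \<Sum>j=1..n. centred c n a i j * centred c n b i j)
      = (\<Sum>i=1..n. \<Sum>j=1..n. (a i j - u i - u j) * (b i j - v i - v j))"
  proof -
    have "centred c n a i j = a i j - u i - u j" "centred c n b i j = b i j - v i - v j" for i j
      by (simp_all add: centred_def u_def v_def)
    then show ?thesis by simp
  qed
  also have "\<dots> = (real n)\<^sup>2 * mean_prod n a b
      - 2 * n * (\<Sum>i=1..n. v i * row_mean n a i) - 2 * n * (\<Sum>i=1..n. u i * row_mean n b i)
      + 2 * real n * (\<Sum>i=1..n. u i * v i) + 2 * (\<Sum>i=1..n. u i) * (\<Sum>i=1..n. v i)"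
  proof -
    have "(\<Sum>i=1..n. v i * (n * row_mean n a i)) = n * (\<Sum>i=1..n. v i * row_mean n a i)"
      "(\<Sum>i=1..n. u i * (n * row_mean n b i)) = n * (\<Sum>i=1..n. u i * row_mean n b i)"
      by (simp_all add: sum_distrib_left mult.left_commute)
    then show ?thesis
      unfolding sum_prod_minus_margins[of a b, OF a b] ra rb p by simp
  qed
  also have "\<dots> = (real n)\<^sup>2 * (mean_prod n a b + (2 * c\<^sup>2 - 4 * c) * row_mean_prod n a b
        + (2 * c - c\<^sup>2) * (grand_mean n a * grand_mean n b))"
    unfolding su sv su' sv' suv by (simp add: power2_eq_square algebra_simps)
  finally show ?thesis .
qed

lemma sum_centred_prod_diag:
  fixes a b :: "nat \<Rightarrow> nat \<Rightarrow> real"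
  assumes n: "n \<ge> 1" and a: "\<And>i. a i i = 0" and b: "\<And>i. b i i = 0"
  shows "(\<Sum>i=1..n. centred c n a i i * centred c n b i i)
    = n * c\<^sup>2 * (4 * row_mean_prod n a b - 3 * (grand_mean n a * grand_mean n b))"
proof -
  have ga: "(\<Sum>i=1..n. row_mean n a i) = n * grand_mean n a"
    and gb: "(\<Sum>i=1..n. row_mean n b i) = n * grand_mean n b"
    using n by (simp_all add: grand_mean_def)
  have q: "(\<Sum>i=1..n. row_mean n a i * row_mean n b i) = n * row_mean_prod n a b"
    using n by (simp add: row_mean_prod_def)
  have "(\<Sum>i=1..n. centred c n a i i * centred c n b i i)
      = (\<Sum>i=1..n. 4 * c\<^sup>2 * (row_mean n a i * row_mean n b i)
          - 2 * c\<^sup>2 * grand_mean n b * row_mean n a i - 2 * c\<^sup>2 * grand_mean n a * row_mean n b i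
          + c\<^sup>2 * (grand_mean n a * grand_mean n b))"
    using a b by (intro sum.cong refl) (simp add: centred_def power2_eq_square algebra_simps)
  also have "\<dots> = n * c\<^sup>2 * (4 * row_mean_prod n a b - 3 * (grand_mean n a * grand_mean n b))"
    unfolding sum.distrib sum_subtractf sum_distrib_left[symmetric] ga gb q
    by (simp add: algebra_simps)
  finally show ?thesis .
qed

lemma centred_minus_margins:
  assumes n: "n \<ge> 1"
  shows "centred 1 n (\<lambda>i j. s * (a i j - p i - p j + m)) i j = s * centred 1 n a i j"
proof -
  define t where "t = (\<Sum>k=1..n. p k) / n"
  have r: "row_mean n (\<lambda>i j. s * (a i j - p i - p j + m)) i = s * (row_mean n a i - p i - t + m)" for i
    unfolding row_mean_def t_def sum_distrib_left[symmetric] sum.distrib sum_subtractf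
    using n by (simp add: field_simps)
  have g: "grand_mean n (\<lambda>i j. s * (a i j - p i - p j + m)) = s * (grand_mean n a - 2 * t + m)"
    unfolding grand_mean_def r sum_distrib_left[symmetric] sum.distrib sum_subtractf
    using n by (simp add: t_def field_simps)
  show ?thesis
    unfolding centred_def r g by (simp add: algebra_simps)
qed

lemma mean_sq_le: "((\<Sum>k=1..n. f k) / real n)\<^sup>2 \<le> (\<Sum>k=1..n. (f k)\<^sup>2) / n" for f :: "nat \<Rightarrow> real"
proof (cases "n = 0")
  case False
  have "(\<Sum>k=1..n. f k)\<^sup>2 \<le> n * (\<Sum>k=1..n. (f k)\<^sup>2)"
    using Cauchy_Schwarz_ineq_sum[of "\<lambda>_. 1" f "{1..n}"] by simp
  then show ?thesis
    using False by (simp add: power_divide divide_simps power2_eq_square mult.commute)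
qed simp

lemma mult_le_half_sum_sq: "\<bar>u * v\<bar> \<le> (u\<^sup>2 + v\<^sup>2) / 2" for u v :: real
  using sum_squares_bound[of "\<bar>u\<bar>" "\<bar>v\<bar>"] by (simp add: abs_mult)

lemma abs_grand_mean_prod_le:
  "\<bar>grand_mean n a * grand_mean n b\<bar> \<le> (\<Sum>i=1..n. (row_mean n a i)\<^sup>2 + (row_mean n b i)\<^sup>2) / (2 * n)"
proof -
  have "\<bar>grand_mean n a * grand_mean n b\<bar> \<le> ((grand_mean n a)\<^sup>2 + (grand_mean n b)\<^sup>2) / 2"
    by (rule mult_le_half_sum_sq)
  also have "\<dots> \<le> ((\<Sum>i=1..n. (row_mean n a i)\<^sup>2) / n + (\<Sum>i=1..n. (row_mean n b i)\<^sup>2) / n) / 2"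
    unfolding grand_mean_def by (intro divide_right_mono add_mono mean_sq_le) simp
  also have "\<dots> = (\<Sum>i=1..n. (row_mean n a i)\<^sup>2 + (row_mean n b i)\<^sup>2) / (2 * n)"
    by (simp add: sum.distrib add_divide_distrib)
  finally show ?thesis .
qed

lemma abs_row_mean_prod_le:
  "\<bar>row_mean_prod n a b\<bar> \<le> (\<Sum>i=1..n. (row_mean n a i)\<^sup>2 + (row_mean n b i)\<^sup>2) / (2 * n)"
proof -
  have "\<bar>row_mean_prod n a b\<bar> \<le> (\<Sum>i=1..n. \<bar>row_mean n a i * row_mean n b i\<bar>) / n"
    unfolding row_mean_prod_def by (simp add: divide_right_mono sum_abs)
  also have "\<dots> \<le> (\<Sum>i=1..n. ((row_mean n a i)\<^sup>2 + (row_mean n b i)\<^sup>2) / 2) / n"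
    by (intro divide_right_mono sum_mono mult_le_half_sum_sq) simp
  finally show ?thesis by (simp add: sum_divide_distrib)
qed

lemma abs_mean_prod_le:
  "\<bar>mean_prod n a b\<bar> \<le> (\<Sum>i=1..n. \<Sum>j=1..n. (a i j)\<^sup>2 + (b i j)\<^sup>2) / (2 * (real n)\<^sup>2)"
proof -
  have "\<bar>mean_prod n a b\<bar> \<le> (\<Sum>i=1..n. \<Sum>j=1..n. \<bar>a i j * b i j\<bar>) / (real n)\<^sup>2"
    unfolding mean_prod_def
    by (simp add: divide_right_mono order_trans[OF sum_abs sum_mono[OF sum_abs]])
  also have "\<dots> \<le> (\<Sum>i=1..n. \<Sum>j=1..n. ((a i j)\<^sup>2 + (b i j)\<^sup>2) / 2) / (real n)\<^sup>2"
    by (intro divide_right_mono sum_mono mult_le_half_sum_sq) simp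
  finally show ?thesis by (simp add: sum_divide_distrib)
qed

lemma sum_sq_row_mean_le:
  "(\<Sum>i=1..n. (row_mean n a i)\<^sup>2 + (row_mean n b i)\<^sup>2) / (2 * n)
    \<le> (\<Sum>i=1..n. \<Sum>j=1..n. (a i j)\<^sup>2 + (b i j)\<^sup>2) / (2 * (real n)\<^sup>2)"
proof -
  have "(\<Sum>i=1..n. (row_mean n a i)\<^sup>2 + (row_mean n b i)\<^sup>2)
      \<le> (\<Sum>i=1..n. (\<Sum>j=1..n. (a i j)\<^sup>2) / n + (\<Sum>j=1..n. (b i j)\<^sup>2) / n)"
    unfolding row_mean_def by (intro sum_mono add_mono mean_sq_le)
  also have "\<dots> = (\<Sum>i=1..n. \<Sum>j=1..n. (a i j)\<^sup>2 + (b i j)\<^sup>2) / n"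
    by (simp add: sum.distrib sum_divide_distrib[symmetric] add_divide_distrib)
  finally have "(\<Sum>i=1..n. (row_mean n a i)\<^sup>2 + (row_mean n b i)\<^sup>2) / (2 * n)
      \<le> (\<Sum>i=1..n. \<Sum>j=1..n. (a i j)\<^sup>2 + (b i j)\<^sup>2) / n / (2 * n)"
    by (rule divide_right_mono) simp
  then show ?thesis by (simp add: power2_eq_square mult.left_commute)
qed

section \<open>The three estimators as combinations of von Mises statistics\<close>

definition dist_mat :: "(nat \<Rightarrow> real) \<Rightarrow> nat \<Rightarrow> nat \<Rightarrow> real" where
  "dist_mat x i j = \<bar>x i - x j\<bar>"

lemma dist_mat_sym: "dist_mat x i j = dist_mat x j i"
  by (simp add: dist_mat_def abs_minus_commute)

lemma dist_mat_diag [simp]: "dist_mat x i i = 0"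
  by (simp add: dist_mat_def)

lemma A_emp_eq: "A_emp n x i = row_mean n (dist_mat x) i"
  by (simp add: A_emp_def row_mean_def dist_mat_def)

lemma B_emp_eq: "B_emp n x = grand_mean n (dist_mat x)"
  by (simp add: B_emp_def grand_mean_def A_emp_eq)

lemma h_hat_eq: "h_hat n x i j = - (1/2) * centred 1 n (dist_mat x) i j"
  by (simp add: h_hat_def centred_def A_emp_eq B_emp_eq dist_mat_def)

lemma h_tilde_eq: "h_tilde n x i j = - (1/2) * centred (real n / (real n - 1)) n (dist_mat x) i j"
  by (simp add: h_tilde_def centred_def A_emp_eq B_emp_eq dist_mat_def)

text \<open>Double centring annihilates matrices of the form \<open>u i + u j\<close>, and \<open>h_fun\<close> differs from
  \<open>- \<bar>x i - x j\<bar> / 2\<close> by such a matrix.\<close>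

lemma h_hat_eq_h_fun:
  assumes "n \<ge> 1"
  shows "h_hat n x i j = centred 1 n (\<lambda>i j. h_fun F (x i) (x j)) i j"
proof -
  have "(\<lambda>i j. h_fun F (x i) (x j))
      = (\<lambda>i j. - (1/2) * (dist_mat x i j - g_at F (x i) - g_at F (x j) + g_mean F))"
    by (simp add: h_fun_def dist_mat_def fun_eq_iff)
  then show ?thesis
    using centred_minus_margins[OF assms, of "- (1/2)" "dist_mat x" "\<lambda>i. g_at F (x i)" "g_mean F" i j]
    by (simp add: h_hat_eq)
qed

lemma h_fun_sym: "h_fun F z w = h_fun F w z"
  by (simp add: h_fun_def abs_minus_commute)

lemma kappa_hat_eq_h_fun:
  fixes x y :: "nat \<Rightarrow> real" and F G :: "real measure"
  assumes "n \<ge> 1"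
  defines "a \<equiv> \<lambda>i j. h_fun F (x i) (x j)" and "b \<equiv> \<lambda>i j. h_fun G (y i) (y j)"
  shows "kappa_hat n x y = mean_prod n a b - 2 * row_mean_prod n a b + grand_mean n a * grand_mean n b"
proof -
  have "kappa_hat n x y = (\<Sum>i=1..n. \<Sum>j=1..n. centred 1 n a i j * centred 1 n b i j) / (real n)\<^sup>2"
    using assms(1) unfolding a_def b_def by (simp add: kappa_hat_def h_hat_eq_h_fun[symmetric])
  also have "\<dots> = mean_prod n a b - 2 * row_mean_prod n a b + grand_mean n a * grand_mean n b"
    using assms(1) by (subst sum_centred_prod) (auto simp: a_def b_def h_fun_sym)
  finally show ?thesis .
qed

lemma kappa_hat_eq:
  assumes "n \<ge> 1"
  shows "kappa_hat n x y = 1/4 * (mean_prod n (dist_mat x) (dist_mat y)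
      - 2 * row_mean_prod n (dist_mat x) (dist_mat y)
      + grand_mean n (dist_mat x) * grand_mean n (dist_mat y))"
proof -
  have "kappa_hat n x y
      = 1/4 * (\<Sum>i=1..n. \<Sum>j=1..n. centred 1 n (dist_mat x) i j * centred 1 n (dist_mat y) i j) / (real n)\<^sup>2"
    by (simp add: kappa_hat_def h_hat_eq sum_divide_distrib[symmetric])
  then show ?thesis
    using assms by (subst (asm) sum_centred_prod) (auto simp: dist_mat_sym)
qed

lemma real_choose_two: "n \<ge> 2 \<Longrightarrow> real (n choose 2) = n * (real n - 1) / 2"
  by (simp add: choose_two of_nat_diff real_of_nat_div)

lemma real_choose_three: "n \<ge> 3 \<Longrightarrow> real (n choose 3) = n * (real n - 1) * (real n - 2) / 6"
  by (simp add: binomial_gbinomial gbinomial_prod_rev numeral_3_eq_3 fact_numeral field_simps)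

lemma kappa_tilde_eq:
  assumes "n \<ge> 2"
  defines "c \<equiv> real n / (real n - 1)"
  shows "kappa_tilde n x y = 1/4 * (c * mean_prod n (dist_mat x) (dist_mat y)
      + (c * (2 * c\<^sup>2 - 4 * c) - 4 * c\<^sup>2 / (real n - 1)) * row_mean_prod n (dist_mat x) (dist_mat y)
      + (c * (2 * c - c\<^sup>2) + 3 * c\<^sup>2 / (real n - 1)) * (grand_mean n (dist_mat x) * grand_mean n (dist_mat y)))"
proof -
  let ?P = "mean_prod n (dist_mat x) (dist_mat y)" and ?Q = "row_mean_prod n (dist_mat x) (dist_mat y)"
    and ?G = "grand_mean n (dist_mat x) * grand_mean n (dist_mat y)"
  let ?h = "\<lambda>i j. centred c n (dist_mat x) i j * centred c n (dist_mat y) i j"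
  have h_sym: "?h i j = ?h j i" for i j
    by (simp add: centred_def dist_mat_sym[of x i j] dist_mat_sym[of y i j] algebra_simps)
  have "2 * (\<Sum>i=1..n. \<Sum>j\<in>{i<..n}. ?h i j) = (\<Sum>i=1..n. \<Sum>j=1..n. ?h i j) - (\<Sum>i=1..n. ?h i i)"
    using sum_symmetric_split[of ?h n] h_sym by simp
  also have "\<dots> = (real n)\<^sup>2 * (?P + (2 * c\<^sup>2 - 4 * c) * ?Q + (2 * c - c\<^sup>2) * ?G)
      - n * c\<^sup>2 * (4 * ?Q - 3 * ?G)"
    using assms(1) sum_centred_prod[of n "dist_mat x" "dist_mat y" c, OF _ dist_mat_sym dist_mat_sym]
      sum_centred_prod_diag[of n "dist_mat x" "dist_mat y" c] by simp
  finally have sum: "2 * (\<Sum>i=1..n. \<Sum>j\<in>{i<..n}. ?h i j) = \<dots>" .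
  have "kappa_tilde n x y = 1/4 * ((2 * (\<Sum>i=1..n. \<Sum>j\<in>{i<..n}. ?h i j)) / (n * (real n - 1)))"
    using assms(1)
    by (simp add: kappa_tilde_def h_tilde_eq real_choose_two c_def sum_divide_distrib[symmetric])
  also have "(2 * (\<Sum>i=1..n. \<Sum>j\<in>{i<..n}. ?h i j)) / (n * (real n - 1))
      = c * (?P + (2 * c\<^sup>2 - 4 * c) * ?Q + (2 * c - c\<^sup>2) * ?G)
        - c\<^sup>2 / (real n - 1) * (4 * ?Q - 3 * ?G)"
    using assms(1) unfolding sum diff_divide_distrib
    by (simp add: c_def power2_eq_square mult.assoc)
  finally show ?thesis by (simp add: algebra_simps)
qed

text \<open>The six terms are the values of \<open>q\<close> at the six orders of a triple of distinct indices. In the full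
  sum, the remaining triples contribute only where the last two indices agree.\<close>

lemma sum_ordered_triples:
  fixes q :: "nat \<Rightarrow> nat \<Rightarrow> nat \<Rightarrow> real"
  assumes q1: "\<And>i k. q i i k = 0" and q2: "\<And>i j. q i j i = 0"
  shows "(\<Sum>i=1..n. \<Sum>j\<in>{i<..n}. \<Sum>k\<in>{j<..n}.
      q i j k + q i k j + q j i k + q j k i + q k i j + q k j i)
    = (\<Sum>i=1..n. \<Sum>j=1..n. \<Sum>k=1..n. q i j k) - (\<Sum>i=1..n. \<Sum>j=1..n. q i j j)"
proof -
  let ?S = "\<lambda>f. \<Sum>i=1..n. \<Sum>j=1..n. \<Sum>k=1..n. f i j k :: real"
  let ?I = "\<lambda>i j k. if i < j \<and> j < k then 1 else 0 :: real"
  have swap12: "?S f = ?S (\<lambda>i j k. f j i k)" for f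
    by (rule sum.swap)
  have swap23: "?S f = ?S (\<lambda>i j k. f i k j)" for f
    by (rule sum.cong[OF refl sum.swap])
  have tail: "(\<Sum>j\<in>{i<..n}. f j) = (\<Sum>j=1..n. if i < j then f j else 0)" for i and f :: "nat \<Rightarrow> real"
    by (intro sum.mono_neutral_cong_left) auto
  have ordered: "(\<Sum>i=1..n. \<Sum>j\<in>{i<..n}. \<Sum>k\<in>{j<..n}. f i j k) = ?S (\<lambda>i j k. ?I i j k * f i j k)" for f
    unfolding tail
  proof (rule sum.cong[OF refl], rule sum.cong[OF refl])
    fix i j
    show "(if i < j then \<Sum>k=1..n. if j < k then f i j k else 0 else 0) = (\<Sum>k=1..n. ?I i j k * f i j k)"
      by (cases "i < j") (auto intro!: sum.cong)
  qed
  have "(\<Sum>i=1..n. \<Sum>j\<in>{i<..n}. \<Sum>k\<in>{j<..n}. q i j k + q i k j + q j i k + q j k i + q k i j + q k j i)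
    = ?S (\<lambda>i j k. ?I i j k * q i j k) + ?S (\<lambda>i j k. ?I i j k * q i k j)
      + ?S (\<lambda>i j k. ?I i j k * q j i k) + ?S (\<lambda>i j k. ?I i j k * q j k i)
      + ?S (\<lambda>i j k. ?I i j k * q k i j) + ?S (\<lambda>i j k. ?I i j k * q k j i)"
    unfolding ordered by (simp only: distrib_left sum.distrib)
  also have "?S (\<lambda>i j k. ?I i j k * q i k j) = ?S (\<lambda>i j k. ?I i k j * q i j k)"
    by (rule swap23)
  also have "?S (\<lambda>i j k. ?I i j k * q j i k) = ?S (\<lambda>i j k. ?I j i k * q i j k)"
    by (rule swap12)
  also have "?S (\<lambda>i j k. ?I i j k * q j k i) = ?S (\<lambda>i j k. ?I k i j * q i j k)"
    by (rule trans[OF swap12 swap23])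
  also have "?S (\<lambda>i j k. ?I i j k * q k i j) = ?S (\<lambda>i j k. ?I j k i * q i j k)"
    by (rule trans[OF swap23 swap12])
  also have "?S (\<lambda>i j k. ?I i j k * q k j i) = ?S (\<lambda>i j k. ?I k j i * q i j k)"
    by (rule trans[OF swap12 trans[OF swap23 swap12]])
  also have "?S (\<lambda>i j k. ?I i j k * q i j k) + ?S (\<lambda>i j k. ?I i k j * q i j k)
      + ?S (\<lambda>i j k. ?I j i k * q i j k) + ?S (\<lambda>i j k. ?I k i j * q i j k)
      + ?S (\<lambda>i j k. ?I j k i * q i j k) + ?S (\<lambda>i j k. ?I k j i * q i j k)
      = ?S (\<lambda>i j k. (?I i j k + ?I i k j + ?I j i k + ?I k i j + ?I j k i + ?I k j i) * q i j k)"
    by (simp only: distrib_right sum.distrib)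
  also have "\<dots> = ?S (\<lambda>i j k. q i j k - (if k = j then q i j j else 0))"
  proof (intro sum.cong refl)
    fix i j k
    show "(?I i j k + ?I i k j + ?I j i k + ?I k i j + ?I j k i + ?I k j i) * q i j k
        = q i j k - (if k = j then q i j j else 0)"
      by (cases i j rule: linorder_cases; cases j k rule: linorder_cases;
          cases i k rule: linorder_cases; simp add: q1 q2)
  qed
  also have "\<dots> = ?S q - (\<Sum>i=1..n. \<Sum>j=1..n. q i j j)"
    by (simp add: sum_subtractf)
  finally show ?thesis .
qed

lemma U3_eq:
  assumes "n \<ge> 3"
  shows "U3 n x y = ((real n)\<^sup>2 * row_mean_prod n (dist_mat x) (dist_mat y)
      - n * mean_prod n (dist_mat x) (dist_mat y)) / ((real n - 1) * (real n - 2))"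
proof -
  let ?q = "\<lambda>i j k. dist_mat x i j * dist_mat y i k"
  let ?Q = "row_mean_prod n (dist_mat x) (dist_mat y)" and ?P = "mean_prod n (dist_mat x) (dist_mat y)"
  have kernel: "h_kernel (x i, y i) (x j, y j) (x k, y k)
      = 1/6 * (?q i j k + ?q i k j + ?q j i k + ?q j k i + ?q k i j + ?q k j i)" for i j k
    by (simp add: dist_mat_def)
  have "(\<Sum>i=1..n. \<Sum>j\<in>{i<..n}. \<Sum>k\<in>{j<..n}. h_kernel (x i, y i) (x j, y j) (x k, y k))
      = 1/6 * (\<Sum>i=1..n. \<Sum>j\<in>{i<..n}. \<Sum>k\<in>{j<..n}.
          ?q i j k + ?q i k j + ?q j i k + ?q j k i + ?q k i j + ?q k j i)"
    by (simp only: kernel sum_distrib_left)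
  also have "\<dots> = 1/6 * ((\<Sum>i=1..n. \<Sum>j=1..n. \<Sum>k=1..n. ?q i j k) - (\<Sum>i=1..n. \<Sum>j=1..n. ?q i j j))"
    by (intro arg_cong[where f = "\<lambda>t. 1/6 * t"] sum_ordered_triples) auto
  also have "(\<Sum>i=1..n. \<Sum>j=1..n. \<Sum>k=1..n. ?q i j k) = real n ^ 3 * ?Q"
  proof -
    have "(\<Sum>i=1..n. \<Sum>j=1..n. \<Sum>k=1..n. ?q i j k)
        = (\<Sum>i=1..n. (\<Sum>j=1..n. dist_mat x i j) * (\<Sum>k=1..n. dist_mat y i k))"
      by (rule sum.cong[OF refl]) (rule sum_product[symmetric])
    also have "\<dots> = real n ^ 3 * ?Q"
      using assms
      by (simp add: row_mean_prod_def row_mean_def sum_divide_distrib[symmetric] power3_eq_cube)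
    finally show ?thesis .
  qed
  also have "(\<Sum>i=1..n. \<Sum>j=1..n. ?q i j j) = (real n)\<^sup>2 * ?P"
    using assms by (simp add: mean_prod_def)
  finally have "U3 n x y = 1 / (n * (real n - 1) * (real n - 2)) * (real n ^ 3 * ?Q - (real n)\<^sup>2 * ?P)"
    using assms by (simp add: U3_def real_choose_three)
  also have "\<dots> = ((real n)\<^sup>2 * ?Q - n * ?P) / ((real n - 1) * (real n - 2))"
    using assms by (simp add: divide_simps power2_eq_square power3_eq_cube) (simp add: algebra_simps)
  finally show ?thesis .
qed

lemma sum_above_diagonal:
  fixes f :: "nat \<Rightarrow> nat \<Rightarrow> real"
  assumes "\<And>i j. f i j = f j i" "\<And>i. f i i = 0"
  shows "(\<Sum>i=1..n. \<Sum>j\<in>{i<..n}. f i j) = (\<Sum>i=1..n. \<Sum>j=1..n. f i j) / 2"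
  using sum_symmetric_split[of f n, OF assms(1)] assms(2) by simp

lemma U1_eq:
  assumes "n \<ge> 2"
  shows "U1 n x = n / (real n - 1) * grand_mean n (dist_mat x)"
proof -
  have *: "(\<Sum>i=1..n. \<Sum>j\<in>{i<..n}. dist_mat x i j) = (real n)\<^sup>2 * grand_mean n (dist_mat x) / 2"
    using assms by (subst sum_above_diagonal)
      (auto simp: dist_mat_sym grand_mean_def row_mean_def sum_divide_distrib[symmetric] power2_eq_square)
  have "U1 n x = 1 / real (n choose 2) * (\<Sum>i=1..n. \<Sum>j\<in>{i<..n}. dist_mat x i j)"
    by (simp add: U1_def dist_mat_def)
  then show ?thesis
    using assms unfolding * real_choose_two[OF assms]
    by (simp add: power2_eq_square divide_simps) (simp add: algebra_simps)
qed

lemma U12_eq: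
  assumes "n \<ge> 2"
  shows "U12 n x y = n / (real n - 1) * mean_prod n (dist_mat x) (dist_mat y)"
proof -
  have *: "(\<Sum>i=1..n. \<Sum>j\<in>{i<..n}. dist_mat x i j * dist_mat y i j)
      = (real n)\<^sup>2 * mean_prod n (dist_mat x) (dist_mat y) / 2"
    using assms by (subst sum_above_diagonal) (auto simp: mean_prod_def dist_mat_def abs_minus_commute)
  have "U12 n x y
      = 1 / real (n choose 2) * (\<Sum>i=1..n. \<Sum>j\<in>{i<..n}. dist_mat x i j * dist_mat y i j)"
    by (simp add: U12_def dist_mat_def)
  then show ?thesis
    using assms unfolding * real_choose_two[OF assms]
    by (simp add: power2_eq_square divide_simps) (simp add: algebra_simps)
qed

lemma kappa_star_eq:
  assumes "n \<ge> 3"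
  shows "kappa_star n x y = 1/4 * (
      (real n / (real n - 1) + 2 * n / ((real n - 1) * (real n - 2))) * mean_prod n (dist_mat x) (dist_mat y)
      + (- 2 * (real n)\<^sup>2 / ((real n - 1) * (real n - 2))) * row_mean_prod n (dist_mat x) (dist_mat y)
      + (real n / (real n - 1))\<^sup>2 * (grand_mean n (dist_mat x) * grand_mean n (dist_mat y)))"
  using assms unfolding kappa_star_def
  by (simp add: U1_eq U12_eq U3_eq power2_eq_square diff_divide_distrib algebra_simps)

section \<open>Orthogonality in samples of independent, identically distributed variables\<close>

lemma integrable_mult_square_integrable:
  fixes f g :: "'a \<Rightarrow> real"
  assumes [measurable]: "f \<in> borel_measurable M" "g \<in> borel_measurable M"
    and "integrable M (\<lambda>x. (f x)\<^sup>2)" "integrable M (\<lambda>x. (g x)\<^sup>2)"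
  shows "integrable M (\<lambda>x. f x * g x)"
proof (rule Bochner_Integration.integrable_bound)
  show "integrable M (\<lambda>x. (f x)\<^sup>2 + (g x)\<^sup>2)" using assms by auto
  have "\<bar>a * b\<bar> \<le> a\<^sup>2 + b\<^sup>2" for a b :: real
    using sum_squares_bound[of "\<bar>a\<bar>" "\<bar>b\<bar>"] mult_nonneg_nonneg[of "\<bar>a\<bar>" "\<bar>b\<bar>"]
    unfolding abs_mult by (simp add: mult.assoc del: mult_nonneg_nonneg)
  then show "AE x in M. norm (f x * g x) \<le> norm ((f x)\<^sup>2 + (g x)\<^sup>2)" by simp
qed simp

lemma expectation_sum_sq_orthogonal:
  fixes V :: "'i \<Rightarrow> 'a \<Rightarrow> real"
  assumes "finite S"
    and [measurable]: "\<And>a. a \<in> S \<Longrightarrow> V a \<in> borel_measurable M"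
    and sq: "\<And>a. a \<in> S \<Longrightarrow> integrable M (\<lambda>x. (V a x)\<^sup>2)"
    and orth: "\<And>a b. a \<in> S \<Longrightarrow> b \<in> S \<Longrightarrow> a \<noteq> b \<Longrightarrow> (\<integral>x. V a x * V b x \<partial>M) = 0"
  shows "integrable M (\<lambda>x. (\<Sum>a\<in>S. V a x)\<^sup>2)"
    and "(\<integral>x. (\<Sum>a\<in>S. V a x)\<^sup>2 \<partial>M) = (\<Sum>a\<in>S. \<integral>x. (V a x)\<^sup>2 \<partial>M)"
proof -
  have int: "integrable M (\<lambda>x. V a x * V b x)" if "a \<in> S" "b \<in> S" for a b
    using that sq by (intro integrable_mult_square_integrable) auto
  have eq: "(\<Sum>a\<in>S. V a x)\<^sup>2 = (\<Sum>a\<in>S. \<Sum>b\<in>S. V a x * V b x)" for x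
    by (simp add: power2_eq_square sum_product)
  show "integrable M (\<lambda>x. (\<Sum>a\<in>S. V a x)\<^sup>2)"
    unfolding eq using int by auto
  have "(\<integral>x. (\<Sum>a\<in>S. V a x)\<^sup>2 \<partial>M) = (\<Sum>a\<in>S. \<Sum>b\<in>S. \<integral>x. V a x * V b x \<partial>M)"
    unfolding eq using int by simp
  also have "\<dots> = (\<Sum>a\<in>S. \<Sum>b\<in>S. if b = a then \<integral>x. (V a x)\<^sup>2 \<partial>M else 0)"
    using orth by (intro sum.cong refl) (auto simp: power2_eq_square)
  also have "\<dots> = (\<Sum>a\<in>S. \<integral>x. (V a x)\<^sup>2 \<partial>M)"
    using \<open>finite S\<close> by simp
  finally show "(\<integral>x. (\<Sum>a\<in>S. V a x)\<^sup>2 \<partial>M) = (\<Sum>a\<in>S. \<integral>x. (V a x)\<^sup>2 \<partial>M)" .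
qed

lemma integrable_sq_bound:
  fixes f :: "'a \<Rightarrow> real"
  assumes "integrable L g" "f \<in> borel_measurable L" "\<And>x. (f x)\<^sup>2 \<le> g x"
  shows "integrable L (\<lambda>x. (f x)\<^sup>2)"
  using assms(2,3)
  by (intro Bochner_Integration.integrable_bound[OF assms(1)]) (auto intro: order_trans[OF _ abs_ge_self])

text \<open>The sample is indexed from 1, as in the definitions of the estimators.\<close>

locale iid_sample = prob_space M for M :: "'a measure" +
  fixes N :: "'z measure" and Z :: "nat \<Rightarrow> 'a \<Rightarrow> 'z" and F :: "'z measure"
  assumes indep: "indep_vars (\<lambda>_. N) Z {1..}"
    and dist: "\<And>i. i \<ge> 1 \<Longrightarrow> distr M N (Z i) = F"
begin

lemma measurable_Z [measurable]: "i \<ge> 1 \<Longrightarrow> Z i \<in> measurable M N"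
  using indep unfolding indep_vars_def by auto

lemma sets_F [simp, measurable_cong]: "sets F = sets N"
  using dist[of 1] by auto

lemma space_F [simp]: "space F = space N"
  by (rule sets_eq_imp_space_eq) simp

lemma prob_space_F: "prob_space F"
  using prob_space_distr[OF measurable_Z[of 1]] dist[of 1] by simp

sublocale F: prob_space F
  by (rule prob_space_F)

sublocale FF: pair_prob_space F F ..

lemma measure_F [simp]: "measure F (space N) = 1"
  using F.prob_space by simp

lemma integral_Z:
  fixes f :: "'z \<Rightarrow> real"
  assumes "i \<ge> 1" "f \<in> borel_measurable N"
  shows "expectation (\<lambda>\<omega>. f (Z i \<omega>)) = (\<integral>z. f z \<partial>F)"
    and "integrable M (\<lambda>\<omega>. f (Z i \<omega>)) \<longleftrightarrow> integrable F f"
  using assms by (auto simp: integral_distr integrable_distr_eq simp flip: dist[OF assms(1)])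

lemma distr_pair_Z:
  assumes "i \<ge> 1" "j \<ge> 1" "i \<noteq> j"
  shows "distr M (N \<Otimes>\<^sub>M N) (\<lambda>\<omega>. (Z i \<omega>, Z j \<omega>)) = F \<Otimes>\<^sub>M F"
proof -
  have "indep_var (PiM {i} (\<lambda>_. N)) (\<lambda>\<omega>. restrict (\<lambda>i. Z i \<omega>) {i})
      (PiM {j} (\<lambda>_. N)) (\<lambda>\<omega>. restrict (\<lambda>i. Z i \<omega>) {j})"
    using assms by (intro indep_var_restrict[OF indep]) auto
  from indep_var_compose[OF this, of "\<lambda>f. f i" N "\<lambda>f. f j" N]
  have "indep_var N (Z i) N (Z j)" by (simp add: comp_def)
  then show ?thesis
    using dist assms unfolding indep_var_distribution_eq by metis
qed

lemma integral_pair_Z: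
  fixes f :: "'z \<times> 'z \<Rightarrow> real"
  assumes "i \<ge> 1" "j \<ge> 1" "i \<noteq> j" and [measurable]: "f \<in> borel_measurable (N \<Otimes>\<^sub>M N)"
  shows "expectation (\<lambda>\<omega>. f (Z i \<omega>, Z j \<omega>)) = (\<integral>p. f p \<partial>(F \<Otimes>\<^sub>M F))"
    and "integrable M (\<lambda>\<omega>. f (Z i \<omega>, Z j \<omega>)) \<longleftrightarrow> integrable (F \<Otimes>\<^sub>M F) f"
  using assms by (auto simp: integral_distr integrable_distr_eq simp flip: distr_pair_Z[OF assms(1-3)])

text \<open>\<open>Z l\<close> is independent of all other variables in the product, so integrating it out first gives
  zero. If the product is not integrable, its expectation is zero by convention.\<close>

lemma expectation_mult_centred:
  fixes G R :: "'z \<times> 'z \<Rightarrow> real"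
  assumes ge: "i \<ge> 1" "j \<ge> 1" "k \<ge> 1" "l \<ge> 1" and l: "l \<notin> {i, j, k}"
    and [measurable]: "G \<in> borel_measurable (N \<Otimes>\<^sub>M N)" "R \<in> borel_measurable (N \<Otimes>\<^sub>M N)"
    and centred: "\<And>z. z \<in> space N \<Longrightarrow> (\<integral>w. R (z, w) \<partial>F) = 0"
  shows "expectation (\<lambda>\<omega>. G (Z i \<omega>, Z j \<omega>) * R (Z k \<omega>, Z l \<omega>)) = 0"
proof (cases "integrable M (\<lambda>\<omega>. G (Z i \<omega>, Z j \<omega>) * R (Z k \<omega>, Z l \<omega>))")
  case True
  let ?A = "PiM {i, j, k} (\<lambda>_. N)" and ?B = "PiM {l} (\<lambda>_. N)"
  let ?X = "\<lambda>\<omega>. restrict (\<lambda>i. Z i \<omega>) {i, j, k}" and ?Y = "\<lambda>\<omega>. restrict (\<lambda>i. Z i \<omega>) {l}"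
  let ?f = "\<lambda>(a, b). G (a i, a j) * R (a k, b l)"
  have "indep_var ?A ?X ?B ?Y"
    using ge l by (intro indep_var_restrict[OF indep]) auto
  note XY = this[unfolded indep_var_distribution_eq]
  note X [measurable] = XY[THEN conjunct1] and Y [measurable] = XY[THEN conjunct2, THEN conjunct1]
    and D = XY[THEN conjunct2, THEN conjunct2]
  interpret X: prob_space "distr M ?A ?X" by (rule prob_space_distr) measurable
  interpret Y: prob_space "distr M ?B ?Y" by (rule prob_space_distr) measurable
  interpret XY: pair_prob_space "distr M ?A ?X" "distr M ?B ?Y" ..
  have [measurable]: "?f \<in> borel_measurable (?A \<Otimes>\<^sub>M ?B)" by measurable
  have inner: "(\<integral>b. ?f (a, b) \<partial>distr M ?B ?Y) = 0" if a: "a \<in> space ?A" for a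
  proof -
    have ak: "a k \<in> space N" using a by (auto simp: space_PiM)
    have [measurable]: "(\<lambda>w. R (a k, w)) \<in> borel_measurable N"
      by (rule measurable_compose[OF measurable_Pair1'[OF ak]]) measurable
    have "(\<integral>b. R (a k, b l) \<partial>distr M ?B ?Y) = expectation (\<lambda>\<omega>. R (a k, ?Y \<omega> l))"
      by (rule integral_distr) (auto intro: measurable_compose[OF measurable_component_singleton])
    also have "\<dots> = (\<integral>w. R (a k, w) \<partial>F)"
      using integral_Z(1)[of l "\<lambda>w. R (a k, w)"] ge by simp
    finally show ?thesis using centred[OF ak] by simp
  qed
  have "integrable (distr M ?A ?X \<Otimes>\<^sub>M distr M ?B ?Y) ?f"
    unfolding D using True by (subst integrable_distr_eq) auto
  then have "(\<integral>p. ?f p \<partial>(distr M ?A ?X \<Otimes>\<^sub>M distr M ?B ?Y))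
      = (\<integral>a. \<integral>b. ?f (a, b) \<partial>distr M ?B ?Y \<partial>distr M ?A ?X)"
    by (rule XY.integral_fst'[symmetric])
  also have "\<dots> = (\<integral>a. 0 \<partial>distr M ?A ?X)"
    using inner by (intro Bochner_Integration.integral_cong refl) simp
  also have "(\<integral>p. ?f p \<partial>(distr M ?A ?X \<Otimes>\<^sub>M distr M ?B ?Y))
      = expectation (\<lambda>\<omega>. G (Z i \<omega>, Z j \<omega>) * R (Z k \<omega>, Z l \<omega>))"
    unfolding D by (subst integral_distr) auto
  finally show ?thesis by simp
qed (rule not_integrable_integral_eq)

text \<open>A kernel centred in its second argument has row means of order \<open>1 / sqrt n\<close>: distinct entries
  of a row are orthogonal.\<close>

lemma second_moment_row_mean:
  fixes R :: "'z \<times> 'z \<Rightarrow> real"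
  assumes [measurable]: "R \<in> borel_measurable (N \<Otimes>\<^sub>M N)"
    and centred: "\<And>z. z \<in> space N \<Longrightarrow> (\<integral>w. R (z, w) \<partial>F) = 0"
    and sq: "integrable (F \<Otimes>\<^sub>M F) (\<lambda>p. (R p)\<^sup>2)"
    and sq_diag: "integrable F (\<lambda>z. (R (z, z))\<^sup>2)"
    and i: "i \<in> {1..n}"
  shows "integrable M (\<lambda>\<omega>. ((\<Sum>k=1..n. R (Z i \<omega>, Z k \<omega>)) / n)\<^sup>2)"
    and "expectation (\<lambda>\<omega>. ((\<Sum>k=1..n. R (Z i \<omega>, Z k \<omega>)) / n)\<^sup>2)
      \<le> ((\<integral>p. (R p)\<^sup>2 \<partial>(F \<Otimes>\<^sub>M F)) + (\<integral>z. (R (z, z))\<^sup>2 \<partial>F)) / n"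
proof -
  let ?V = "\<lambda>k \<omega>. R (Z i \<omega>, Z k \<omega>)"
  let ?c = "(\<integral>p. (R p)\<^sup>2 \<partial>(F \<Otimes>\<^sub>M F)) + (\<integral>z. (R (z, z))\<^sup>2 \<partial>F)"
  have [measurable]: "Z i \<in> measurable M N" using i by auto
  have meas [measurable]: "?V k \<in> borel_measurable M" if "k \<in> {1..n}" for k
    using that i by (auto intro!: measurable_compose[OF _ assms(1)] measurable_Pair)
  have sq_V: "integrable M (\<lambda>\<omega>. (?V k \<omega>)\<^sup>2)" and le_V: "expectation (\<lambda>\<omega>. (?V k \<omega>)\<^sup>2) \<le> ?c"
    if "k \<in> {1..n}" for k
    using i that integral_Z[of i "\<lambda>z. (R (z, z))\<^sup>2"] integral_pair_Z[of i k "\<lambda>p. (R p)\<^sup>2"] sq sq_diag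
    by (cases "k = i"; simp)+
  have orth: "expectation (\<lambda>\<omega>. ?V k \<omega> * ?V l \<omega>) = 0"
    if "k \<in> {1..n}" "l \<in> {1..n}" "k \<noteq> l" for k l
  proof (cases "l = i")
    case False
    then show ?thesis
      using that i by (intro expectation_mult_centred centred) auto
  next
    case True
    then have "expectation (\<lambda>\<omega>. ?V l \<omega> * ?V k \<omega>) = 0"
      using that i by (intro expectation_mult_centred centred) auto
    then show ?thesis by (simp add: mult.commute)
  qed
  note * = expectation_sum_sq_orthogonal[of "{1..n}" ?V, OF _ meas sq_V orth]
  show "integrable M (\<lambda>\<omega>. ((\<Sum>k=1..n. R (Z i \<omega>, Z k \<omega>)) / n)\<^sup>2)"
    using *(1) by (simp add: power_divide)
  have "expectation (\<lambda>\<omega>. ((\<Sum>k=1..n. ?V k \<omega>) / n)\<^sup>2) = (\<Sum>k=1..n. expectation (\<lambda>\<omega>. (?V k \<omega>)\<^sup>2)) / n\<^sup>2"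
    using *(2) by (simp add: power_divide)
  also have "\<dots> \<le> (n * ?c) / n\<^sup>2"
    using sum_bounded_above[of "{1..n}" "\<lambda>k. expectation (\<lambda>\<omega>. (?V k \<omega>)\<^sup>2)" ?c] le_V
    by (intro divide_right_mono) auto
  also have "\<dots> = ?c / n" by (simp add: power2_eq_square)
  finally show "expectation (\<lambda>\<omega>. ((\<Sum>k=1..n. ?V k \<omega>) / n)\<^sup>2) \<le> ?c / n" .
qed

text \<open>For a symmetric centred kernel, all entries above the diagonal are orthogonal: of two distinct
  index pairs, each has an index that the other lacks.\<close>

lemma second_moment_degenerate_sum:
  fixes R :: "'z \<times> 'z \<Rightarrow> real"
  assumes [measurable]: "R \<in> borel_measurable (N \<Otimes>\<^sub>M N)"
    and sym: "\<And>z w. R (z, w) = R (w, z)"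
    and centred: "\<And>z. z \<in> space N \<Longrightarrow> (\<integral>w. R (z, w) \<partial>F) = 0"
    and sq: "integrable (F \<Otimes>\<^sub>M F) (\<lambda>p. (R p)\<^sup>2)"
  shows "integrable M (\<lambda>\<omega>. (\<Sum>i=1..n. \<Sum>j\<in>{i<..n}. R (Z i \<omega>, Z j \<omega>))\<^sup>2)"
    and "expectation (\<lambda>\<omega>. (\<Sum>i=1..n. \<Sum>j\<in>{i<..n}. R (Z i \<omega>, Z j \<omega>))\<^sup>2)
      \<le> (real n)\<^sup>2 * (\<integral>p. (R p)\<^sup>2 \<partial>(F \<Otimes>\<^sub>M F))"
proof -
  let ?S = "Sigma {1..n} (\<lambda>i. {i<..n})"
  let ?V = "\<lambda>(i, j) \<omega>. R (Z i \<omega>, Z j \<omega>)"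
  let ?c = "\<integral>p. (R p)\<^sup>2 \<partial>(F \<Otimes>\<^sub>M F)"
  have meas: "?V a \<in> borel_measurable M" if "a \<in> ?S" for a
  proof -
    have [measurable]: "Z (fst a) \<in> measurable M N" "Z (snd a) \<in> measurable M N"
      using that by auto
    show ?thesis unfolding case_prod_unfold by measurable
  qed
  have sq_V: "integrable M (\<lambda>\<omega>. (?V a \<omega>)\<^sup>2)" and eq_V: "expectation (\<lambda>\<omega>. (?V a \<omega>)\<^sup>2) = ?c"
    if "a \<in> ?S" for a
    using that integral_pair_Z[of "fst a" "snd a" "\<lambda>p. (R p)\<^sup>2"] sq
    by (auto simp: case_prod_unfold)
  have orth: "expectation (\<lambda>\<omega>. ?V a \<omega> * ?V b \<omega>) = 0" if ab: "a \<in> ?S" "b \<in> ?S" "a \<noteq> b" for a b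
  proof -
    obtain i j where a: "a = (i, j)" by (cases a)
    obtain k l where b: "b = (k, l)" by (cases b)
    have "l \<notin> {i, j, k} \<or> k \<notin> {i, j, l}" using ab a b by auto
    then show ?thesis
    proof
      assume "l \<notin> {i, j, k}"
      then show ?thesis
        using ab a b by (auto intro!: expectation_mult_centred centred)
    next
      assume "k \<notin> {i, j, l}"
      then have "expectation (\<lambda>\<omega>. R (Z i \<omega>, Z j \<omega>) * R (Z l \<omega>, Z k \<omega>)) = 0"
        using ab a b by (intro expectation_mult_centred centred) auto
      then show ?thesis by (simp add: a b sym[of "Z k _"])
    qed
  qed
  note * = expectation_sum_sq_orthogonal[of ?S ?V, OF _ meas sq_V orth]
  have eq: "(\<Sum>i=1..n. \<Sum>j\<in>{i<..n}. R (Z i \<omega>, Z j \<omega>)) = (\<Sum>a\<in>?S. ?V a \<omega>)" for \<omega>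
    by (subst sum.Sigma) (auto simp: case_prod_unfold)
  show "integrable M (\<lambda>\<omega>. (\<Sum>i=1..n. \<Sum>j\<in>{i<..n}. R (Z i \<omega>, Z j \<omega>))\<^sup>2)"
    unfolding eq using *(1) by simp
  have "card ?S \<le> card ({1..n} \<times> {1..n})"
    by (rule card_mono) auto
  also have "\<dots> = n * n"
    by (simp only: card_cartesian_product card_atLeastAtMost diff_Suc_1)
  finally have "card ?S \<le> n * n" .
  then have "real (card ?S) \<le> (real n)\<^sup>2"
    unfolding power2_eq_square by (simp only: of_nat_le_iff flip: of_nat_mult)
  moreover have "?c \<ge> 0" by simp
  ultimately have "card ?S * ?c \<le> (real n)\<^sup>2 * ?c"
    by (intro mult_right_mono)
  then show "expectation (\<lambda>\<omega>. (\<Sum>i=1..n. \<Sum>j\<in>{i<..n}. R (Z i \<omega>, Z j \<omega>))\<^sup>2) \<le> (real n)\<^sup>2 * ?c"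
    unfolding eq using *(2) eq_V by simp
qed

text \<open>The square of the mean of a section is at most the mean of its square, since a variance is
  nonnegative.\<close>

lemma integrable_projection_sq:
  fixes H :: "'z \<times> 'z \<Rightarrow> real"
  assumes [measurable]: "H \<in> borel_measurable (N \<Otimes>\<^sub>M N)"
    and int: "\<And>z. z \<in> space N \<Longrightarrow> integrable F (\<lambda>w. H (z, w))"
    and sq: "integrable (F \<Otimes>\<^sub>M F) (\<lambda>p. (H p)\<^sup>2)"
  shows "integrable F (\<lambda>z. (\<integral>w. H (z, w) \<partial>F)\<^sup>2)"
proof (rule Bochner_Integration.integrable_bound)
  show "integrable F (\<lambda>z. \<integral>w. (H (z, w))\<^sup>2 \<partial>F)"
    using FF.integrable_fst'[OF sq] by simp
  show "AE z in F. norm ((\<integral>w. H (z, w) \<partial>F)\<^sup>2) \<le> norm (\<integral>w. (H (z, w))\<^sup>2 \<partial>F)"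
    using FF.AE_integrable_fst'[OF sq] AE_space
  proof eventually_elim
    case (elim z)
    then show ?case
      using F.variance_eq[OF int elim(1)] F.variance_positive[of "\<lambda>w. H (z, w)"] by simp
  qed
qed measurable

text \<open>Hoeffding's projection method for the von Mises statistic of a symmetric kernel. Subtracting
  both one-argument projections leaves a centred kernel, whose double sum has orthogonal
  off-diagonal terms and hence is of order \<open>n\<close> instead of \<open>n\<^sup>2\<close>; the diagonal is of that
  order as well.\<close>

lemma hoeffding_projection_close:
  fixes H :: "'z \<times> 'z \<Rightarrow> real"
  assumes [measurable]: "H \<in> borel_measurable (N \<Otimes>\<^sub>M N)"
    and sym: "\<And>z w. H (z, w) = H (w, z)"
    and int: "\<And>z. z \<in> space N \<Longrightarrow> integrable F (\<lambda>w. H (z, w))"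
    and sq: "integrable (F \<Otimes>\<^sub>M F) (\<lambda>p. (H p)\<^sup>2)"
    and diag: "integrable F (\<lambda>z. H (z, z))"
  defines "\<theta> \<equiv> \<integral>p. H p \<partial>(F \<Otimes>\<^sub>M F)" and "P \<equiv> \<lambda>z. \<integral>w. H (z, w) \<partial>F"
  defines "D \<equiv> \<lambda>n \<omega>. (\<Sum>i=1..n. \<Sum>j=1..n. H (Z i \<omega>, Z j \<omega>)) / (real n)\<^sup>2 - \<theta>
      - 2 / n * (\<Sum>i=1..n. P (Z i \<omega>) - \<theta>)"
  shows "\<exists>C. \<forall>n\<ge>1. integrable M (D n) \<and> expectation (\<lambda>\<omega>. \<bar>D n \<omega>\<bar>) \<le> C / n"
proof -
  have H_int: "integrable (F \<Otimes>\<^sub>M F) H"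
    by (rule FF.P.square_integrable_imp_integrable[OF _ sq]) simp
  have P_meas [measurable]: "P \<in> borel_measurable N"
    unfolding P_def by measurable
  have P_sq: "integrable F (\<lambda>z. (P z)\<^sup>2)"
    unfolding P_def using int sq by (intro integrable_projection_sq) auto
  have P_int: "integrable F P"
    by (rule F.square_integrable_imp_integrable[OF _ P_sq]) simp
  have P_mean: "(\<integral>z. P z \<partial>F) = \<theta>"
    unfolding P_def \<theta>_def using FF.integral_fst'[OF H_int] by simp
  define R where "R = (\<lambda>p. H p - P (fst p) - P (snd p) + \<theta>)"
  have R_meas [measurable]: "R \<in> borel_measurable (N \<Otimes>\<^sub>M N)"
    unfolding R_def by measurable
  have R_sym: "R (z, w) = R (w, z)" for z w
    using sym[of z w] by (simp add: R_def)
  have centred: "(\<integral>w. R (z, w) \<partial>F) = 0" if "z \<in> space N" for z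
    using int[OF that] P_int P_mean by (simp add: R_def P_def)
  have P_fst_sq: "integrable (F \<Otimes>\<^sub>M F) (\<lambda>p. (P (fst p))\<^sup>2)"
    and P_snd_sq: "integrable (F \<Otimes>\<^sub>M F) (\<lambda>p. (P (snd p))\<^sup>2)"
    using integral_pair_Z(2)[of 1 2 "\<lambda>p. (P (fst p))\<^sup>2"] integral_Z(2)[of 1 "\<lambda>z. (P z)\<^sup>2"]
      integral_pair_Z(2)[of 1 2 "\<lambda>p. (P (snd p))\<^sup>2"] integral_Z(2)[of 2 "\<lambda>z. (P z)\<^sup>2"] P_sq
    by auto
  have R_sq: "integrable (F \<Otimes>\<^sub>M F) (\<lambda>p. (R p)\<^sup>2)"
  proof (rule Bochner_Integration.integrable_bound)
    show "integrable (F \<Otimes>\<^sub>M F) (\<lambda>p. 4 * ((H p)\<^sup>2 + (P (fst p))\<^sup>2 + (P (snd p))\<^sup>2 + \<theta>\<^sup>2))"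
      using sq P_fst_sq P_snd_sq by auto
    have "(a - b - c + d)\<^sup>2 \<le> 4 * (a\<^sup>2 + b\<^sup>2 + c\<^sup>2 + d\<^sup>2)" for a b c d :: real
    proof -
      have "4 * (a\<^sup>2 + b\<^sup>2 + c\<^sup>2 + d\<^sup>2) - (a - b - c + d)\<^sup>2
          = (a + b)\<^sup>2 + (a + c)\<^sup>2 + (a - d)\<^sup>2 + (b - c)\<^sup>2 + (b + d)\<^sup>2 + (c + d)\<^sup>2"
        by (simp add: power2_eq_square algebra_simps)
      moreover have "\<dots> \<ge> 0" by simp
      ultimately show ?thesis by linarith
    qed
    then show "AE p in F \<Otimes>\<^sub>M F. norm ((R p)\<^sup>2)
        \<le> norm (4 * ((H p)\<^sup>2 + (P (fst p))\<^sup>2 + (P (snd p))\<^sup>2 + \<theta>\<^sup>2))"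
      unfolding R_def by simp
  qed measurable
  have R_diag: "integrable F (\<lambda>z. R (z, z))"
    using diag P_int by (simp add: R_def)
  let ?\<rho> = "\<integral>p. (R p)\<^sup>2 \<partial>(F \<Otimes>\<^sub>M F)" and ?\<tau> = "\<integral>z. \<bar>R (z, z)\<bar> \<partial>F"
  have "integrable M (D n) \<and> expectation (\<lambda>\<omega>. \<bar>D n \<omega>\<bar>) \<le> (2 * (1 + ?\<rho>) + ?\<tau>) / n" if n: "n \<ge> 1" for n
  proof -
    let ?T = "\<lambda>\<omega>. \<Sum>i=1..n. \<Sum>j\<in>{i<..n}. R (Z i \<omega>, Z j \<omega>)"
    let ?E = "\<lambda>\<omega>. \<Sum>i=1..n. R (Z i \<omega>, Z i \<omega>)"
    have D_eq: "D n \<omega> = (2 * ?T \<omega> + ?E \<omega>) / (real n)\<^sup>2" for \<omega>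
    proof -
      have "2 * ?T \<omega> + ?E \<omega> = (\<Sum>i=1..n. \<Sum>j=1..n. R (Z i \<omega>, Z j \<omega>))"
        using sum_symmetric_split[of "\<lambda>i j. R (Z i \<omega>, Z j \<omega>)" n] R_sym by simp
      also have "\<dots> = (\<Sum>i=1..n. \<Sum>j=1..n. H (Z i \<omega>, Z j \<omega>))
          - 2 * n * (\<Sum>i=1..n. P (Z i \<omega>)) + (real n)\<^sup>2 * \<theta>"
        by (simp add: R_def sum.distrib sum_subtractf power2_eq_square algebra_simps
            flip: sum_distrib_left)
      also have "\<dots> = (real n)\<^sup>2 * D n \<omega>"
        using n unfolding D_def by (simp add: sum_subtractf field_simps power2_eq_square)
      finally show ?thesis
        using n by (simp add: field_simps)
    qed
    have T_meas: "?T \<in> borel_measurable M"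
      by (intro borel_measurable_sum measurable_compose[OF _ R_meas] measurable_Pair measurable_Z) auto
    note T = second_moment_degenerate_sum[OF R_meas R_sym centred R_sq, of n]
    have T_int: "integrable M ?T"
      by (rule square_integrable_imp_integrable[OF T_meas T(1)])
    \<comment> \<open>\<open>?T\<close> is of order \<open>n\<close> in mean square, so the weight \<open>n\<close> balances the two terms.\<close>
    have "expectation (\<lambda>\<omega>. \<bar>?T \<omega>\<bar>) \<le> expectation (\<lambda>\<omega>. n + (?T \<omega>)\<^sup>2 / n)"
    proof (rule integral_mono)
      fix \<omega>
      have "2 * n * \<bar>?T \<omega>\<bar> \<le> n\<^sup>2 + (?T \<omega>)\<^sup>2"
        using sum_squares_bound[of "real n" "\<bar>?T \<omega>\<bar>"] by simp
      then have "n * \<bar>?T \<omega>\<bar> \<le> n\<^sup>2 + (?T \<omega>)\<^sup>2"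
        using mult_nonneg_nonneg[of "real n" "\<bar>?T \<omega>\<bar>"] by linarith
      then show "\<bar>?T \<omega>\<bar> \<le> n + (?T \<omega>)\<^sup>2 / n"
        using n by (simp add: field_simps power2_eq_square)
    qed (use T_int T(1) in auto)
    also have "\<dots> = n + expectation (\<lambda>\<omega>. (?T \<omega>)\<^sup>2) / n"
      using T(1) by (simp add: prob_space)
    also have "\<dots> \<le> n + ((real n)\<^sup>2 * ?\<rho>) / n"
      using T(2) by (intro add_left_mono divide_right_mono) auto
    also have "\<dots> = n * (1 + ?\<rho>)"
      by (simp add: power2_eq_square algebra_simps)
    finally have ET: "expectation (\<lambda>\<omega>. \<bar>?T \<omega>\<bar>) \<le> n * (1 + ?\<rho>)" .
    have R_diag_i: "integrable M (\<lambda>\<omega>. R (Z i \<omega>, Z i \<omega>))"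
        "expectation (\<lambda>\<omega>. \<bar>R (Z i \<omega>, Z i \<omega>)\<bar>) = ?\<tau>" if "i \<in> {1..n}" for i
      using that R_diag integral_Z[of i "\<lambda>z. R (z, z)"] integral_Z[of i "\<lambda>z. \<bar>R (z, z)\<bar>"] by auto
    have E_int: "integrable M ?E"
      using R_diag_i by auto
    have "expectation (\<lambda>\<omega>. \<bar>?E \<omega>\<bar>) \<le> expectation (\<lambda>\<omega>. \<Sum>i=1..n. \<bar>R (Z i \<omega>, Z i \<omega>)\<bar>)"
      using R_diag_i E_int by (intro integral_mono sum_abs) auto
    also have "\<dots> = n * ?\<tau>"
      using R_diag_i by (simp add: Bochner_Integration.integral_sum)
    finally have EE: "expectation (\<lambda>\<omega>. \<bar>?E \<omega>\<bar>) \<le> n * ?\<tau>" .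
    have D_int: "integrable M (D n)"
      unfolding D_eq using T_int E_int by auto
    have "expectation (\<lambda>\<omega>. \<bar>D n \<omega>\<bar>) \<le> expectation (\<lambda>\<omega>. (2 * \<bar>?T \<omega>\<bar> + \<bar>?E \<omega>\<bar>) / (real n)\<^sup>2)"
    proof (rule integral_mono)
      fix \<omega>
      have "\<bar>2 * ?T \<omega> + ?E \<omega>\<bar> \<le> 2 * \<bar>?T \<omega>\<bar> + \<bar>?E \<omega>\<bar>" by linarith
      then show "\<bar>D n \<omega>\<bar> \<le> (2 * \<bar>?T \<omega>\<bar> + \<bar>?E \<omega>\<bar>) / (real n)\<^sup>2"
        unfolding D_eq by (simp add: divide_right_mono)
    qed (use D_int T_int E_int in auto)
    also have "\<dots> = (2 * expectation (\<lambda>\<omega>. \<bar>?T \<omega>\<bar>) + expectation (\<lambda>\<omega>. \<bar>?E \<omega>\<bar>)) / (real n)\<^sup>2"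
      using T_int E_int by simp
    also have "\<dots> \<le> (2 * (n * (1 + ?\<rho>)) + n * ?\<tau>) / (real n)\<^sup>2"
      using ET EE by (intro divide_right_mono add_mono mult_left_mono) auto
    also have "\<dots> = (2 * (1 + ?\<rho>) + ?\<tau>) / n"
      using n by (simp add: field_simps power2_eq_square)
    finally show ?thesis using D_int by simp
  qed
  then show ?thesis by blast
qed

text \<open>By symmetry both arguments of the kernel have the same projection \<open>P\<close>, so the linear part of the
  statistic is twice the average of \<open>P\<close>; hence the factor \<open>4\<close>.\<close>

lemma von_Mises_clt:
  fixes H :: "'z \<times> 'z \<Rightarrow> real"
  assumes [measurable]: "H \<in> borel_measurable (N \<Otimes>\<^sub>M N)"
    and sym: "\<And>z w. H (z, w) = H (w, z)"
    and int: "\<And>z. z \<in> space N \<Longrightarrow> integrable F (\<lambda>w. H (z, w))"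
    and sq: "integrable (F \<Otimes>\<^sub>M F) (\<lambda>p. (H p)\<^sup>2)"
    and diag: "integrable F (\<lambda>z. H (z, z))"
  defines "\<theta> \<equiv> \<integral>p. H p \<partial>(F \<Otimes>\<^sub>M F)" and "P \<equiv> \<lambda>z. \<integral>w. H (z, w) \<partial>F"
  shows "weak_conv_m
    (\<lambda>n. distr M borel (\<lambda>\<omega>. sqrt n *
      ((\<Sum>i=1..n. \<Sum>j=1..n. H (Z i \<omega>, Z j \<omega>)) / (real n)\<^sup>2 - \<theta>)))
    (normal_law 0 (4 * F.variance P))"
proof -
  have P_meas [measurable]: "P \<in> borel_measurable N"
    unfolding P_def by measurable
  have P_sq: "integrable F (\<lambda>z. (P z)\<^sup>2)"
    unfolding P_def using int sq by (intro integrable_projection_sq) auto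
  have P_int: "integrable F P"
    by (rule F.square_integrable_imp_integrable[OF _ P_sq]) simp
  have H_int: "integrable (F \<Otimes>\<^sub>M F) H"
    by (rule FF.P.square_integrable_imp_integrable[OF _ sq]) simp
  have P_mean: "(\<integral>z. P z \<partial>F) = \<theta>"
    unfolding P_def \<theta>_def using FF.integral_fst'[OF H_int] by simp
  have sq_centred: "integrable F (\<lambda>z. (P z - \<theta>)\<^sup>2)"
    using P_sq P_int by (simp add: power2_diff)
  let ?L = "\<lambda>z. 2 * (P z - \<theta>)"
  \<comment> \<open>The sample is indexed from 1, the summands of the central limit theorem from 0.\<close>
  let ?V = "\<lambda>i \<omega>. ?L (Z (Suc i) \<omega>)"
  let ?D = "\<lambda>n \<omega>. (\<Sum>i=1..n. \<Sum>j=1..n. H (Z i \<omega>, Z j \<omega>)) / (real n)\<^sup>2 - \<theta>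
      - 2 / n * (\<Sum>i=1..n. P (Z i \<omega>) - \<theta>)"
  have indep_V: "indep_vars (\<lambda>_. borel) ?V UNIV"
  proof -
    have "indep_vars (\<lambda>j. PiM {Suc j} (\<lambda>_. N)) (\<lambda>j \<omega>. restrict (\<lambda>i. Z i \<omega>) {Suc j}) UNIV"
      by (rule indep_vars_restrict[OF indep]) (auto simp: disjoint_family_on_def)
    from indep_vars_compose2[OF this, of "\<lambda>j f. ?L (f (Suc j))" "\<lambda>_. borel"]
    show ?thesis by simp
  qed
  have dist_V: "distr M borel (?V n) = distr F borel ?L" for n
  proof -
    have "distr F borel ?L = distr (distr M N (Z (Suc n))) borel ?L" by (simp add: dist)
    also have "\<dots> = distr M borel (?V n)" by (subst distr_distr) (auto simp: comp_def)
    finally show ?thesis by simp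
  qed
  have "expectation (?V n) = 0" for n
    using integral_Z(1)[of "Suc n" ?L] P_int P_mean by simp
  moreover have "integrable M (\<lambda>\<omega>. (?V n \<omega>)\<^sup>2)" for n
    using integral_Z(2)[of "Suc n" "\<lambda>z. (?L z)\<^sup>2"] sq_centred
    by (simp add: power_mult_distrib del: right_diff_distrib_numeral)
  moreover have "expectation (\<lambda>\<omega>. (?V n \<omega>)\<^sup>2) = 4 * F.variance P" for n
  proof -
    have "expectation (\<lambda>\<omega>. (?V n \<omega>)\<^sup>2) = (\<integral>z. 4 * (P z - \<theta>)\<^sup>2 \<partial>F)"
      using integral_Z(1)[of "Suc n" "\<lambda>z. (?L z)\<^sup>2"] unfolding power_mult_distrib by simp
    then show ?thesis by (simp add: P_mean)
  qed
  ultimately have conv: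
    "weak_conv_m (\<lambda>n. distr M borel (\<lambda>\<omega>. (\<Sum>i<n. ?V i \<omega>) / sqrt n)) (normal_law 0 (4 * F.variance P))"
    by (intro clt_normal_law[OF indep_V _ _ _ dist_V])
  obtain C where C: "\<And>n. n \<ge> 1 \<Longrightarrow> integrable M (?D n) \<and> expectation (\<lambda>\<omega>. \<bar>?D n \<omega>\<bar>) \<le> C / n"
    using hoeffding_projection_close[OF assms(1) sym int sq diag] unfolding \<theta>_def P_def by blast
  let ?W = "\<lambda>n \<omega>. (\<Sum>i=1..n. \<Sum>j=1..n. H (Z i \<omega>, Z j \<omega>)) / (real n)\<^sup>2"
  let ?P = "\<lambda>n \<omega>. \<theta> + 2 / n * (\<Sum>i=1..n. P (Z i \<omega>) - \<theta>)"
  have "(\<Sum>i<n. ?V i \<omega>) / sqrt n = sqrt n * (?P n \<omega> - \<theta>)" for n \<omega>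
  proof -
    have "(\<Sum>i=1..n. P (Z i \<omega>) - \<theta>) = (\<Sum>i<n. P (Z (Suc i) \<omega>) - \<theta>)"
      by (rule sum.reindex_bij_witness[of _ Suc "\<lambda>i. i - 1"]) auto
    then have "(\<Sum>i<n. ?V i \<omega>) / sqrt n = 2 * (\<Sum>i=1..n. P (Z i \<omega>) - \<theta>) / sqrt n"
      by (simp only: sum_distrib_left)
    also have "2 * s / sqrt n = sqrt n * (\<theta> + 2 / n * s - \<theta>)" for s
      using sqrt_mult_divide[of n "2 * s"] by simp
    finally show ?thesis .
  qed
  note conv = conv[unfolded this]
  have close: "integrable M (\<lambda>\<omega>. ?W n \<omega> - ?P n \<omega>) \<and> expectation (\<lambda>\<omega>. \<bar>?W n \<omega> - ?P n \<omega>\<bar>) \<le> C / n"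
    if "n \<ge> 1" for n
    using C[OF that] by (simp only: diff_diff_eq)
  have P_Z_meas: "(\<lambda>\<omega>. P (Z i \<omega>)) \<in> borel_measurable M" if "i \<in> {1..n}" for i n
    using that by (intro measurable_compose[OF measurable_Z P_meas]) auto
  have H_Z_meas: "(\<lambda>\<omega>. H (Z i \<omega>, Z j \<omega>)) \<in> borel_measurable M" if "i \<in> {1..n}" "j \<in> {1..n}" for i j n
    using that by (intro measurable_compose[OF _ assms(1)] measurable_Pair measurable_Z) auto
  show ?thesis
  proof (rule weak_conv_m_sqrt_close[OF _ _ _ conv close sqrt_mult_rate_tendsto_0])
    show "random_variable borel (?P n)" for n
      using P_Z_meas by (intro borel_measurable_add borel_measurable_diff borel_measurable_times
          borel_measurable_sum borel_measurable_const)
    show "random_variable borel (?W n)" for n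
      using H_Z_meas by (intro borel_measurable_divide borel_measurable_sum borel_measurable_const)
    show "real_distribution (normal_law 0 (4 * F.variance P))"
      by (rule real_distribution_normal_law) simp
  qed
qed

lemma integrable_pair_mult:
  fixes f g :: "'z \<Rightarrow> real"
  assumes "integrable F f" "integrable F g"
  shows "integrable (F \<Otimes>\<^sub>M F) (\<lambda>w. f (fst w) * g (snd w))"
proof (rule FF.Fubini_integrable)
  have [measurable]: "f \<in> borel_measurable N" "g \<in> borel_measurable N"
    using assms[THEN borel_measurable_integrable] by (auto cong: measurable_cong_sets)
  show "(\<lambda>w. f (fst w) * g (snd w)) \<in> borel_measurable (F \<Otimes>\<^sub>M F)" by measurable
  show "integrable F (\<lambda>z. F.expectation (\<lambda>w. norm (f (fst (z, w)) * g (snd (z, w)))))"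
    using assms by (auto simp: abs_mult)
  show "AE z in F. integrable F (\<lambda>w. f (fst (z, w)) * g (snd (z, w)))"
    using assms by auto
qed

lemma integrable_pair_marginal:
  fixes f :: "'z \<Rightarrow> real"
  assumes "integrable F f"
  shows "integrable (F \<Otimes>\<^sub>M F) (\<lambda>w. f (fst w))" "integrable (F \<Otimes>\<^sub>M F) (\<lambda>w. f (snd w))"
  using integrable_pair_mult[OF assms, of "\<lambda>_. 1"] integrable_pair_mult[OF _ assms, of "\<lambda>_. 1"] by auto

end

section \<open>The kernel of Bergsma's covariance\<close>

lemma sq_sum3_le: "(a + b + c)\<^sup>2 \<le> 3 * (a\<^sup>2 + b\<^sup>2 + c\<^sup>2)" for a b c :: real
proof -
  have "3 * (a\<^sup>2 + b\<^sup>2 + c\<^sup>2) - (a + b + c)\<^sup>2 = (a - b)\<^sup>2 + (a - c)\<^sup>2 + (b - c)\<^sup>2"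
    by (simp add: power2_eq_square algebra_simps)
  moreover have "\<dots> \<ge> 0" by simp
  ultimately show ?thesis by linarith
qed

locale square_integrable_distribution = real_distribution +
  assumes sq: "integrable M (\<lambda>x. x\<^sup>2)"
begin

lemma integrable_id: "integrable M (\<lambda>x. x)"
  by (rule square_integrable_imp_integrable[OF _ sq]) simp

lemma integrable_dist: "integrable M (\<lambda>t. \<bar>s - t\<bar>)"
  using integrable_id by auto

lemma g_at_nonneg: "0 \<le> g_at M s"
  unfolding g_at_def by (rule integral_nonneg_AE) simp

lemma g_at_le: "g_at M s \<le> \<bar>s\<bar> + expectation (\<lambda>t. \<bar>t\<bar>)"
proof -
  have "g_at M s \<le> expectation (\<lambda>t. \<bar>s\<bar> + \<bar>t\<bar>)"
    unfolding g_at_def using integrable_id integrable_dist by (intro integral_mono) auto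
  also have "\<dots> = \<bar>s\<bar> + expectation (\<lambda>t. \<bar>t\<bar>)"
    using integrable_id prob_space by simp
  finally show ?thesis .
qed

lemma measurable_g_at [measurable]: "g_at M \<in> borel_measurable borel"
  unfolding g_at_def by measurable

lemma integrable_g_at_sq: "integrable M (\<lambda>s. (g_at M s)\<^sup>2)"
proof (rule Bochner_Integration.integrable_bound)
  let ?m = "expectation (\<lambda>t. \<bar>t\<bar>)"
  show "integrable M (\<lambda>s. (\<bar>s\<bar> + ?m)\<^sup>2)"
    using sq integrable_id by (simp add: power2_sum)
  have "(g_at M s)\<^sup>2 \<le> (\<bar>s\<bar> + ?m)\<^sup>2" for s
    by (intro power_mono g_at_le g_at_nonneg)
  then show "AE s in M. norm ((g_at M s)\<^sup>2) \<le> norm ((\<bar>s\<bar> + ?m)\<^sup>2)" by simp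
qed measurable

lemma integrable_g_at: "integrable M (g_at M)"
  by (rule square_integrable_imp_integrable[OF _ integrable_g_at_sq]) measurable

lemma g_mean_eq: "g_mean M = expectation (g_at M)"
proof -
  interpret P: pair_prob_space M M ..
  have "integrable (M \<Otimes>\<^sub>M M) (\<lambda>p. \<bar>fst p - snd p\<bar>)"
  proof (rule P.Fubini_integrable)
    show "integrable M (\<lambda>s. expectation (\<lambda>t. norm \<bar>fst (s, t) - snd (s, t)\<bar>))"
      using integrable_g_at unfolding g_at_def[abs_def] by simp
  qed (use integrable_dist in auto)
  from P.integral_fst'[OF this] show ?thesis
    by (simp add: g_mean_def g_at_def[abs_def] case_prod_unfold)
qed

lemma measurable_h_fun [measurable]:
  "(\<lambda>p. h_fun M (fst p) (snd p)) \<in> borel_measurable (borel \<Otimes>\<^sub>M borel)"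
  unfolding h_fun_def by measurable

lemma integral_h_fun: "expectation (h_fun M s) = 0"
proof -
  have "expectation (h_fun M s)
      = expectation (\<lambda>t. - (1/2) * (\<bar>s - t\<bar> - g_at M s - g_at M t + g_mean M))"
    by (simp add: h_fun_def cong: Bochner_Integration.integral_cong)
  also have "\<dots> = - (1/2) * (expectation (\<lambda>t. \<bar>s - t\<bar>) - g_at M s - expectation (g_at M) + g_mean M)"
    using integrable_dist[of s] integrable_g_at prob_space by simp
  also have "\<dots> = 0"
    by (simp add: g_mean_eq) (simp add: g_at_def)
  finally show ?thesis .
qed

lemma h_fun_sq_le: "\<exists>C\<ge>0. \<forall>s t. (h_fun M s t)\<^sup>2 \<le> C * (1 + s\<^sup>2 + t\<^sup>2)"
proof (intro exI[of _ "3 * (1 + expectation (\<lambda>t. \<bar>t\<bar>) + \<bar>g_mean M\<bar>)\<^sup>2"] conjI allI)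
  fix s t
  let ?m = "expectation (\<lambda>t. \<bar>t\<bar>)"
  have m: "?m \<ge> 0" by (rule integral_nonneg_AE) simp
  have "\<bar>h_fun M s t\<bar> \<le> \<bar>s\<bar> + \<bar>t\<bar> + ?m + \<bar>g_mean M\<bar>"
  proof -
    have "\<bar>- (1/2) * (d - a - b + g)\<bar> \<le> s' + t' + m' + g'"
      if "0 \<le> d" "d \<le> s' + t'" "0 \<le> a" "a \<le> s' + m'" "0 \<le> b" "b \<le> t' + m'"
        "- g' \<le> g" "g \<le> g'" "0 \<le> m'" "0 \<le> s'" "0 \<le> t'" for d a b g s' t' m' g' :: real
      using that by (intro abs_leI) (simp_all add: field_simps)
    from this[of "\<bar>s - t\<bar>" "\<bar>s\<bar>" "\<bar>t\<bar>" "g_at M s" ?m "g_at M t" "\<bar>g_mean M\<bar>" "g_mean M"]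
    show ?thesis
      using g_at_le[of s] g_at_le[of t] g_at_nonneg[of s] g_at_nonneg[of t] m
        abs_triangle_ineq4[of s t]
      unfolding h_fun_def by simp
  qed
  also have "\<dots> \<le> (1 + ?m + \<bar>g_mean M\<bar>) * (1 + \<bar>s\<bar> + \<bar>t\<bar>)"
    using m by (simp add: algebra_simps add_nonneg_nonneg)
  finally have "(h_fun M s t)\<^sup>2 \<le> ((1 + ?m + \<bar>g_mean M\<bar>) * (1 + \<bar>s\<bar> + \<bar>t\<bar>))\<^sup>2"
    using power_mono[of "\<bar>h_fun M s t\<bar>" _ 2] by simp
  also have "\<dots> \<le> (1 + ?m + \<bar>g_mean M\<bar>)\<^sup>2 * (3 * (1 + s\<^sup>2 + t\<^sup>2))"
    using sq_sum3_le[of 1 "\<bar>s\<bar>" "\<bar>t\<bar>"] unfolding power_mult_distrib by (intro mult_left_mono) auto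
  finally show "(h_fun M s t)\<^sup>2 \<le> 3 * (1 + ?m + \<bar>g_mean M\<bar>)\<^sup>2 * (1 + s\<^sup>2 + t\<^sup>2)"
    by (simp only: mult_ac)
qed simp

end

text \<open>What concerns a single coordinate of the observations is stated here once, to be used for both.\<close>

locale coordinate_sample = iid_sample +
  fixes p :: "'b \<Rightarrow> real"
  assumes p [measurable]: "p \<in> borel_measurable N" and p_sq: "integrable F (\<lambda>z. (p z)\<^sup>2)"
begin

lemma p_F [simp]: "p \<in> borel_measurable F"
  by measurable

abbreviation "L \<equiv> distr F borel p"

sublocale L: square_integrable_distribution L
proof -
  have "real_distribution L" by simp
  moreover have "integrable L (\<lambda>x. x\<^sup>2)"
    using p_sq by (subst integrable_distr_eq) auto
  ultimately show "square_integrable_distribution L"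
    by (simp add: square_integrable_distribution_def square_integrable_distribution_axioms_def)
qed

lemma integral_L:
  fixes f :: "real \<Rightarrow> real"
  assumes "f \<in> borel_measurable borel"
  shows "L.expectation f = (\<integral>z. f (p z) \<partial>F)" "integrable L f \<longleftrightarrow> integrable F (\<lambda>z. f (p z))"
  by (rule integral_distr[OF p_F assms], rule integrable_distr_eq[OF p_F assms])

lemma integrable_p: "integrable F p"
  by (rule F.square_integrable_imp_integrable[OF p_F p_sq])

lemma measurable_p_Z: "i \<ge> 1 \<Longrightarrow> (\<lambda>\<omega>. p (Z i \<omega>)) \<in> borel_measurable M"
  by (auto intro: measurable_compose[OF measurable_Z])

lemma measurable_h [measurable]: "(\<lambda>w. h_fun L (p (fst w)) (p (snd w))) \<in> borel_measurable (N \<Otimes>\<^sub>M N)"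
  using measurable_compose[of "\<lambda>w. (p (fst w), p (snd w))" "N \<Otimes>\<^sub>M N" "borel \<Otimes>\<^sub>M borel",
      OF _ L.measurable_h_fun] by simp

lemma measurable_h_section: "z \<in> space N \<Longrightarrow> (\<lambda>w. h_fun L (p z) (p w)) \<in> borel_measurable F"
  using measurable_compose[OF measurable_Pair1' measurable_h, of z] by simp

lemma measurable_h_diag: "(\<lambda>z. h_fun L (p z) (p z)) \<in> borel_measurable F"
  using measurable_compose[OF _ measurable_h, of "\<lambda>z. (z, z)"] by simp

lemma integral_h: "(\<integral>w. h_fun L (p z) (p w) \<partial>F) = 0"
proof -
  have "(\<lambda>t. h_fun L (p z) t) \<in> borel_measurable borel"
    using measurable_compose[OF measurable_Pair1' L.measurable_h_fun, of "p z"] by simp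
  then show ?thesis
    using L.integral_h_fun[of "p z"] integral_L(1)[of "h_fun L (p z)"] by simp
qed

lemma integrable_h_sq:
  shows "integrable (F \<Otimes>\<^sub>M F) (\<lambda>w. (h_fun L (p (fst w)) (p (snd w)))\<^sup>2)"
    and "integrable F (\<lambda>z. (h_fun L (p z) (p z))\<^sup>2)"
    and "z \<in> space N \<Longrightarrow> integrable F (\<lambda>w. (h_fun L (p z) (p w))\<^sup>2)"
proof -
  obtain C where C: "\<And>s t. (h_fun L s t)\<^sup>2 \<le> C * (1 + s\<^sup>2 + t\<^sup>2)" using L.h_fun_sq_le by blast
  show "integrable (F \<Otimes>\<^sub>M F) (\<lambda>w. (h_fun L (p (fst w)) (p (snd w)))\<^sup>2)"
    using integrable_pair_marginal[OF p_sq] by (intro integrable_sq_bound[OF _ _ C]) auto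
  show "integrable F (\<lambda>z. (h_fun L (p z) (p z))\<^sup>2)"
    using p_sq measurable_h_diag by (intro integrable_sq_bound[OF _ _ C]) auto
  show "integrable F (\<lambda>w. (h_fun L (p z) (p w))\<^sup>2)" if "z \<in> space N"
    using p_sq measurable_h_section[OF that] by (intro integrable_sq_bound[OF _ _ C]) auto
qed

lemma integrable_dist_sq: "integrable F (\<lambda>w. \<bar>s - p w\<bar>\<^sup>2)"
  using integrable_p p_sq by (auto simp: power2_diff)

lemma integrable_dist_sq_pair: "integrable (F \<Otimes>\<^sub>M F) (\<lambda>w. \<bar>p (fst w) - p (snd w)\<bar>\<^sup>2)"
  using integrable_pair_marginal[OF p_sq] integrable_pair_mult[OF integrable_p integrable_p]
  by (simp add: power2_diff mult.assoc)

lemma integrable_g_at_L_sq: "integrable F (\<lambda>w. (g_at L (p w))\<^sup>2)"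
  using L.integrable_g_at_sq by (subst (asm) integral_L(2)) auto

lemma g_at_L: "g_at L s = (\<integral>w. \<bar>s - p w\<bar> \<partial>F)"
  unfolding g_at_def by (rule integral_L) measurable

lemma g_mean_L: "g_mean L = (\<integral>w. g_at L (p w) \<partial>F)"
  unfolding L.g_mean_eq by (rule integral_L) measurable

lemma expectation_dist_sq_le:
  assumes ij: "i \<ge> 1" "j \<ge> 1"
  shows "integrable M (\<lambda>\<omega>. \<bar>p (Z i \<omega>) - p (Z j \<omega>)\<bar>\<^sup>2)"
    and "expectation (\<lambda>\<omega>. \<bar>p (Z i \<omega>) - p (Z j \<omega>)\<bar>\<^sup>2) \<le> 4 * (\<integral>z. (p z)\<^sup>2 \<partial>F)"
proof -
  have sq: "\<bar>s - t\<bar>\<^sup>2 \<le> 2 * (s\<^sup>2 + t\<^sup>2)" for s t :: real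
  proof -
    have "2 * (s\<^sup>2 + t\<^sup>2) - \<bar>s - t\<bar>\<^sup>2 = (s + t)\<^sup>2" by (simp add: power2_eq_square algebra_simps)
    moreover have "\<dots> \<ge> 0" by simp
    ultimately show ?thesis by linarith
  qed
  have I: "integrable M (\<lambda>\<omega>. (p (Z k \<omega>))\<^sup>2)" "expectation (\<lambda>\<omega>. (p (Z k \<omega>))\<^sup>2) = (\<integral>z. (p z)\<^sup>2 \<partial>F)"
    if "k \<ge> 1" for k
    using integral_Z[OF that, of "\<lambda>z. (p z)\<^sup>2"] p_sq by auto
  have b: "integrable M (\<lambda>\<omega>. 2 * ((p (Z i \<omega>))\<^sup>2 + (p (Z j \<omega>))\<^sup>2))"
    using I ij by auto
  show int: "integrable M (\<lambda>\<omega>. \<bar>p (Z i \<omega>) - p (Z j \<omega>)\<bar>\<^sup>2)"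
    using measurable_p_Z[OF ij(1)] measurable_p_Z[OF ij(2)]
    by (intro integrable_sq_bound[OF b _ sq]) auto
  have "expectation (\<lambda>\<omega>. \<bar>p (Z i \<omega>) - p (Z j \<omega>)\<bar>\<^sup>2)
      \<le> expectation (\<lambda>\<omega>. 2 * ((p (Z i \<omega>))\<^sup>2 + (p (Z j \<omega>))\<^sup>2))"
    using int b sq by (intro integral_mono) auto
  also have "\<dots> = 4 * (\<integral>z. (p z)\<^sup>2 \<partial>F)"
    using I ij by simp
  finally show "expectation (\<lambda>\<omega>. \<bar>p (Z i \<omega>) - p (Z j \<omega>)\<bar>\<^sup>2) \<le> 4 * (\<integral>z. (p z)\<^sup>2 \<partial>F)" .
qed

end

locale iid_pair_sample = iid_sample M N Z F +
    X: coordinate_sample M N Z F p + Y: coordinate_sample M N Z F q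
  for M :: "'a measure" and N :: "'b measure" and Z F and p q :: "'b \<Rightarrow> real" +
  assumes pq_sq: "integrable F (\<lambda>z. (p z)\<^sup>2 * (q z)\<^sup>2)"
begin

abbreviation "F1 \<equiv> distr F borel p"
abbreviation "F2 \<equiv> distr F borel q"

text \<open>\<open>H\<close> is the kernel of the von Mises statistic that approximates \<open>kappa_hat\<close>. Its mean \<open>\<theta>\<close> is
  Bergsma's covariance.\<close>

definition H :: "'b \<times> 'b \<Rightarrow> real" where
  "H w = h_fun F1 (p (fst w)) (p (snd w)) * h_fun F2 (q (fst w)) (q (snd w))"

definition proj :: "'b \<Rightarrow> real" where
  "proj z = (\<integral>w. H (z, w) \<partial>F)"

definition \<theta> :: real where
  "\<theta> = (\<integral>w. H w \<partial>(F \<Otimes>\<^sub>M F))"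

lemma measurable_H [measurable]: "H \<in> borel_measurable (N \<Otimes>\<^sub>M N)"
  unfolding H_def by measurable

lemma H_sym: "H (z, w) = H (w, z)"
  by (simp add: H_def h_fun_sym)

lemma integrable_H_section: "z \<in> space N \<Longrightarrow> integrable F (\<lambda>w. H (z, w))"
  unfolding H_def fst_conv snd_conv
  by (intro integrable_mult_square_integrable X.measurable_h_section Y.measurable_h_section
      X.integrable_h_sq(3) Y.integrable_h_sq(3))

lemma integrable_H_diag: "integrable F (\<lambda>z. H (z, z))"
  unfolding H_def fst_conv snd_conv
  by (intro integrable_mult_square_integrable X.measurable_h_diag Y.measurable_h_diag
      X.integrable_h_sq(2) Y.integrable_h_sq(2))

text \<open>This is where the joint moment condition enters: besides products of independent factors, the
  bound on \<open>H\<^sup>2\<close> contains \<open>(p z)\<^sup>2 (q z)\<^sup>2\<close>.\<close>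

lemma integrable_H_sq: "integrable (F \<Otimes>\<^sub>M F) (\<lambda>w. (H w)\<^sup>2)"
proof -
  obtain C where C: "C \<ge> 0" "\<And>s t. (h_fun F1 s t)\<^sup>2 \<le> C * (1 + s\<^sup>2 + t\<^sup>2)"
    using X.L.h_fun_sq_le by blast
  obtain D where D: "D \<ge> 0" "\<And>s t. (h_fun F2 s t)\<^sup>2 \<le> D * (1 + s\<^sup>2 + t\<^sup>2)"
    using Y.L.h_fun_sq_le by blast
  let ?p = "\<lambda>z. (p z)\<^sup>2" and ?q = "\<lambda>z. (q z)\<^sup>2"
  let ?b = "\<lambda>w. (C * (1 + ?p (fst w) + ?p (snd w))) * (D * (1 + ?q (fst w) + ?q (snd w)))"
  have "integrable (F \<Otimes>\<^sub>M F) (\<lambda>w. C * D * (1 + ?p (fst w) + ?p (snd w) + ?q (fst w) + ?q (snd w)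
      + ?p (fst w) * ?q (fst w) + ?p (snd w) * ?q (snd w)
      + ?p (fst w) * ?q (snd w) + ?q (fst w) * ?p (snd w)))"
    using integrable_pair_marginal[OF X.p_sq] integrable_pair_marginal[OF Y.p_sq]
      integrable_pair_marginal[OF pq_sq] integrable_pair_mult[OF X.p_sq Y.p_sq]
      integrable_pair_mult[OF Y.p_sq X.p_sq]
    by (intro integrable_mult_right Bochner_Integration.integrable_add) auto
  then have "integrable (F \<Otimes>\<^sub>M F) ?b"
    by (simp add: algebra_simps)
  then show ?thesis
  proof (rule integrable_sq_bound)
    show "(H w)\<^sup>2 \<le> ?b w" for w
      unfolding H_def power_mult_distrib using C D by (intro mult_mono) auto
  qed measurable
qed

section \<open>Asymptotic normality of the plug-in estimator\<close>

abbreviation "khat n \<omega> \<equiv> kappa_hat n (\<lambda>i. p (Z i \<omega>)) (\<lambda>i. q (Z i \<omega>))"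
abbreviation "ktilde n \<omega> \<equiv> kappa_tilde n (\<lambda>i. p (Z i \<omega>)) (\<lambda>i. q (Z i \<omega>))"
abbreviation "kstar n \<omega> \<equiv> kappa_star n (\<lambda>i. p (Z i \<omega>)) (\<lambda>i. q (Z i \<omega>))"

lemmas borel_measurable_arith = borel_measurable_sum borel_measurable_times borel_measurable_diff
  borel_measurable_add borel_measurable_divide borel_measurable_abs borel_measurable_const

lemma measurable_khat [measurable]: "khat n \<in> borel_measurable M"
  unfolding kappa_hat_def h_hat_def A_emp_def B_emp_def
  by (intro borel_measurable_arith X.measurable_p_Z Y.measurable_p_Z; simp)

lemma measurable_ktilde [measurable]: "ktilde n \<in> borel_measurable M"
  unfolding kappa_tilde_def h_tilde_def A_emp_def B_emp_def
  by (intro borel_measurable_arith X.measurable_p_Z Y.measurable_p_Z; simp)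

lemma measurable_kstar [measurable]: "kstar n \<in> borel_measurable M"
  unfolding kappa_star_def U1_def U12_def U3_def h_kernel.simps
  by (intro borel_measurable_arith X.measurable_p_Z Y.measurable_p_Z; simp)

text \<open>Written with the values of the centred kernels \<open>h_fun\<close>, the difference consists of products of row
  means and of grand means, and both are bounded by the average of the squared row means.\<close>

lemma khat_close_von_Mises:
  defines "D \<equiv> \<lambda>n \<omega>. khat n \<omega> - (\<Sum>i=1..n. \<Sum>j=1..n. H (Z i \<omega>, Z j \<omega>)) / (real n)\<^sup>2"
  shows "\<exists>C. \<forall>n\<ge>1. integrable M (D n) \<and> expectation (\<lambda>\<omega>. \<bar>D n \<omega>\<bar>) \<le> C / n"
proof -
  let ?c1 = "(\<integral>w. (h_fun F1 (p (fst w)) (p (snd w)))\<^sup>2 \<partial>(F \<Otimes>\<^sub>M F)) + (\<integral>z. (h_fun F1 (p z) (p z))\<^sup>2 \<partial>F)"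
  let ?c2 = "(\<integral>w. (h_fun F2 (q (fst w)) (q (snd w)))\<^sup>2 \<partial>(F \<Otimes>\<^sub>M F)) + (\<integral>z. (h_fun F2 (q z) (q z))\<^sup>2 \<partial>F)"
  have "integrable M (D n) \<and> expectation (\<lambda>\<omega>. \<bar>D n \<omega>\<bar>) \<le> (3/2 * (?c1 + ?c2)) / n" if n: "n \<ge> 1" for n
  proof -
    let ?a = "\<lambda>\<omega> i j. h_fun F1 (p (Z i \<omega>)) (p (Z j \<omega>))"
    let ?b = "\<lambda>\<omega> i j. h_fun F2 (q (Z i \<omega>)) (q (Z j \<omega>))"
    let ?S = "\<lambda>\<omega>. 3/2 * (\<Sum>i=1..n. (row_mean n (?a \<omega>) i)\<^sup>2 + (row_mean n (?b \<omega>) i)\<^sup>2) / n"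
    have D_le: "\<bar>D n \<omega>\<bar> \<le> ?S \<omega>" for \<omega>
    proof -
      have "mean_prod n (?a \<omega>) (?b \<omega>) = (\<Sum>i=1..n. \<Sum>j=1..n. H (Z i \<omega>, Z j \<omega>)) / (real n)\<^sup>2"
        by (simp add: mean_prod_def H_def)
      then have "D n \<omega> = grand_mean n (?a \<omega>) * grand_mean n (?b \<omega>) - 2 * row_mean_prod n (?a \<omega>) (?b \<omega>)"
        unfolding D_def kappa_hat_eq_h_fun[OF n, of _ _ F1 F2] by simp
      then show ?thesis
        using abs_row_mean_prod_le[of n "?a \<omega>" "?b \<omega>"] abs_grand_mean_prod_le[of n "?a \<omega>" "?b \<omega>"]
        by simp
    qed
    have r1: "integrable M (\<lambda>\<omega>. (row_mean n (?a \<omega>) i)\<^sup>2)" "expectation (\<lambda>\<omega>. (row_mean n (?a \<omega>) i)\<^sup>2) \<le> ?c1 / n"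
      if "i \<in> {1..n}" for i
      using second_moment_row_mean[OF X.measurable_h _ X.integrable_h_sq(1) _ that] X.integral_h X.integrable_h_sq(2)
      by (simp_all add: row_mean_def)
    have r2: "integrable M (\<lambda>\<omega>. (row_mean n (?b \<omega>) i)\<^sup>2)" "expectation (\<lambda>\<omega>. (row_mean n (?b \<omega>) i)\<^sup>2) \<le> ?c2 / n"
      if "i \<in> {1..n}" for i
      using second_moment_row_mean[OF Y.measurable_h _ Y.integrable_h_sq(1) _ that] Y.integral_h Y.integrable_h_sq(2)
      by (simp_all add: row_mean_def)
    have S_int: "integrable M ?S"
      using r1(1) r2(1) by (intro integrable_divide integrable_mult_right Bochner_Integration.integrable_sum
          Bochner_Integration.integrable_add) auto
    have H_meas: "(\<lambda>\<omega>. H (Z i \<omega>, Z j \<omega>)) \<in> borel_measurable M" if "i \<in> {1..n}" "j \<in> {1..n}" for i j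
      using that by (intro measurable_compose[OF _ measurable_H] measurable_Pair) auto
    then have "D n \<in> borel_measurable M"
      unfolding D_def by (intro borel_measurable_arith measurable_khat)
    moreover have "norm (D n \<omega>) \<le> norm (?S \<omega>)" for \<omega>
      using order_trans[OF D_le abs_ge_self[of "?S \<omega>"]] unfolding real_norm_def .
    ultimately have D_int: "integrable M (D n)"
      by (intro Bochner_Integration.integrable_bound[OF S_int] AE_I2)
    have "expectation (\<lambda>\<omega>. \<bar>D n \<omega>\<bar>) \<le> expectation ?S"
      using D_int S_int D_le by (intro integral_mono) auto
    also have "\<dots> = 3/2 * (\<Sum>i=1..n. expectation (\<lambda>\<omega>. (row_mean n (?a \<omega>) i)\<^sup>2)
        + expectation (\<lambda>\<omega>. (row_mean n (?b \<omega>) i)\<^sup>2)) / n"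
      using r1(1) r2(1) by simp
    also have "\<dots> \<le> 3/2 * (\<Sum>i=1..n. ?c1 / n + ?c2 / n) / n"
      using r1(2) r2(2) by (intro divide_right_mono mult_left_mono sum_mono add_mono) auto
    also have "\<dots> = (3/2 * (?c1 + ?c2)) / n"
      using n by (simp add: field_simps)
    finally show ?thesis using D_int by simp
  qed
  then show ?thesis by blast
qed

lemma khat_clt:
  "weak_conv_m (\<lambda>n. distr M borel (\<lambda>\<omega>. sqrt n * (khat n \<omega> - \<theta>))) (normal_law 0 (4 * F.variance proj))"
proof -
  let ?V = "\<lambda>n \<omega>. (\<Sum>i=1..n. \<Sum>j=1..n. H (Z i \<omega>, Z j \<omega>)) / (real n)\<^sup>2"
  have conv: "weak_conv_m (\<lambda>n. distr M borel (\<lambda>\<omega>. sqrt n * (?V n \<omega> - \<theta>)))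
      (normal_law 0 (4 * F.variance proj))"
    unfolding \<theta>_def proj_def[abs_def]
    by (rule von_Mises_clt[OF measurable_H H_sym integrable_H_section integrable_H_sq integrable_H_diag])
  obtain C where C: "\<And>n. n \<ge> 1 \<Longrightarrow> integrable M (\<lambda>\<omega>. khat n \<omega> - ?V n \<omega>)
      \<and> expectation (\<lambda>\<omega>. \<bar>khat n \<omega> - ?V n \<omega>\<bar>) \<le> C / n"
    using khat_close_von_Mises by blast
  have V_meas: "?V n \<in> borel_measurable M" for n
    by (intro borel_measurable_arith measurable_compose[OF _ measurable_H] measurable_Pair measurable_Z) auto
  show ?thesis
  proof (rule weak_conv_m_sqrt_close[OF V_meas measurable_khat _ conv C sqrt_mult_rate_tendsto_0])
    show "real_distribution (normal_law 0 (4 * F.variance proj))"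
      by (rule real_distribution_normal_law) simp
  qed
qed

section \<open>Transfer to the other estimators\<close>

lemma abs_quarter_sum_le: "\<bar>1/4 * (u + v + w)\<bar> \<le> \<bar>u\<bar> + \<bar>v\<bar> + \<bar>w\<bar>" for u v w :: real
proof -
  have "\<bar>1/4 * (u + v + w)\<bar> \<le> \<bar>u + v + w\<bar>" unfolding abs_mult by simp
  also have "\<dots> \<le> \<bar>u + v\<bar> + \<bar>w\<bar>" by (rule abs_triangle_ineq)
  also have "\<dots> \<le> \<bar>u\<bar> + \<bar>v\<bar> + \<bar>w\<bar>" by (intro add_right_mono abs_triangle_ineq)
  finally show ?thesis .
qed

lemma expectation_sum_sq_dist_le:
  assumes n: "n \<ge> 1"
  defines "S \<equiv> \<lambda>\<omega>. (\<Sum>i=1..n. \<Sum>j=1..n. (dist_mat (\<lambda>i. p (Z i \<omega>)) i j)\<^sup>2 + (dist_mat (\<lambda>i. q (Z i \<omega>)) i j)\<^sup>2)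
      / (2 * (real n)\<^sup>2)"
  shows "integrable M S" and "expectation S \<le> 2 * ((\<integral>z. (p z)\<^sup>2 \<partial>F) + (\<integral>z. (q z)\<^sup>2 \<partial>F))"
proof -
  have P: "integrable M (\<lambda>\<omega>. \<bar>p (Z i \<omega>) - p (Z j \<omega>)\<bar>\<^sup>2)"
      "expectation (\<lambda>\<omega>. \<bar>p (Z i \<omega>) - p (Z j \<omega>)\<bar>\<^sup>2) \<le> 4 * (\<integral>z. (p z)\<^sup>2 \<partial>F)"
    and Q: "integrable M (\<lambda>\<omega>. \<bar>q (Z i \<omega>) - q (Z j \<omega>)\<bar>\<^sup>2)"
      "expectation (\<lambda>\<omega>. \<bar>q (Z i \<omega>) - q (Z j \<omega>)\<bar>\<^sup>2) \<le> 4 * (\<integral>z. (q z)\<^sup>2 \<partial>F)"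
    if "i \<in> {1..n}" "j \<in> {1..n}" for i j
    using that X.expectation_dist_sq_le[of i j] Y.expectation_dist_sq_le[of i j] by auto
  show "integrable M S"
    unfolding S_def dist_mat_def using P(1) Q(1)
    by (intro integrable_divide Bochner_Integration.integrable_sum Bochner_Integration.integrable_add) auto
  have "expectation S = (\<Sum>i=1..n. \<Sum>j=1..n. expectation (\<lambda>\<omega>. \<bar>p (Z i \<omega>) - p (Z j \<omega>)\<bar>\<^sup>2)
      + expectation (\<lambda>\<omega>. \<bar>q (Z i \<omega>) - q (Z j \<omega>)\<bar>\<^sup>2)) / (2 * (real n)\<^sup>2)"
  proof -
    let ?u = "\<lambda>i j \<omega>. \<bar>p (Z i \<omega>) - p (Z j \<omega>)\<bar>\<^sup>2 + \<bar>q (Z i \<omega>) - q (Z j \<omega>)\<bar>\<^sup>2"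
    have u: "integrable M (?u i j)" "expectation (?u i j)
        = expectation (\<lambda>\<omega>. \<bar>p (Z i \<omega>) - p (Z j \<omega>)\<bar>\<^sup>2) + expectation (\<lambda>\<omega>. \<bar>q (Z i \<omega>) - q (Z j \<omega>)\<bar>\<^sup>2)"
      if "i \<in> {1..n}" "j \<in> {1..n}" for i j
      using P(1)[OF that] Q(1)[OF that]
      by (rule Bochner_Integration.integrable_add, intro Bochner_Integration.integral_add)
    have "expectation S = expectation (\<lambda>\<omega>. \<Sum>i=1..n. \<Sum>j=1..n. ?u i j \<omega>) / (2 * (real n)\<^sup>2)"
      unfolding S_def dist_mat_def by (rule integral_divide_zero)
    also have "expectation (\<lambda>\<omega>. \<Sum>i=1..n. \<Sum>j=1..n. ?u i j \<omega>)
        = (\<Sum>i=1..n. expectation (\<lambda>\<omega>. \<Sum>j=1..n. ?u i j \<omega>))"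
      by (rule Bochner_Integration.integral_sum, rule Bochner_Integration.integrable_sum, rule u(1))
    also have "\<dots> = (\<Sum>i=1..n. \<Sum>j=1..n. expectation (?u i j))"
      by (rule sum.cong[OF refl], rule Bochner_Integration.integral_sum, rule u(1))
    also have "\<dots> = (\<Sum>i=1..n. \<Sum>j=1..n. expectation (\<lambda>\<omega>. \<bar>p (Z i \<omega>) - p (Z j \<omega>)\<bar>\<^sup>2)
        + expectation (\<lambda>\<omega>. \<bar>q (Z i \<omega>) - q (Z j \<omega>)\<bar>\<^sup>2))"
      by (rule sum.cong[OF refl], rule sum.cong[OF refl], rule u(2))
    finally show ?thesis .
  qed
  also have "\<dots> \<le> (\<Sum>i=1..n. \<Sum>j=1..n. 4 * (\<integral>z. (p z)\<^sup>2 \<partial>F) + 4 * (\<integral>z. (q z)\<^sup>2 \<partial>F)) / (2 * (real n)\<^sup>2)"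
    using P(2) Q(2) by (intro divide_right_mono sum_mono add_mono) auto
  also have "\<dots> = 2 * ((\<integral>z. (p z)\<^sup>2 \<partial>F) + (\<integral>z. (q z)\<^sup>2 \<partial>F))"
    using n by (simp add: power2_eq_square field_simps)
  finally show "expectation S \<le> 2 * ((\<integral>z. (p z)\<^sup>2 \<partial>F) + (\<integral>z. (q z)\<^sup>2 \<partial>F))" .
qed

text \<open>The limits of the coefficients are those of \<open>kappa_hat\<close>. As each of the three statistics is bounded
  by the same average of squared distances, whose expectation does not grow with \<open>n\<close>, the estimator
  differs from \<open>kappa_hat\<close> by \<open>o(1 / sqrt n)\<close> in mean.\<close>

lemma estimator_clt:
  fixes est :: "nat \<Rightarrow> (nat \<Rightarrow> real) \<Rightarrow> (nat \<Rightarrow> real) \<Rightarrow> real" and \<alpha> \<beta> \<gamma> :: "nat \<Rightarrow> real"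
  defines "ek \<equiv> \<lambda>n \<omega>. est n (\<lambda>i. p (Z i \<omega>)) (\<lambda>i. q (Z i \<omega>))"
  assumes meas: "\<And>n. ek n \<in> borel_measurable M"
    and eq: "\<And>n x y. n \<ge> 3 \<Longrightarrow> est n x y = 1/4 * (\<alpha> n * mean_prod n (dist_mat x) (dist_mat y)
      + \<gamma> n * row_mean_prod n (dist_mat x) (dist_mat y)
      + \<beta> n * (grand_mean n (dist_mat x) * grand_mean n (dist_mat y)))"
    and \<alpha>: "(\<lambda>n. sqrt n * (\<alpha> n - 1)) \<longlonglongrightarrow> 0"
    and \<gamma>: "(\<lambda>n. sqrt n * (\<gamma> n + 2)) \<longlonglongrightarrow> 0"
    and \<beta>: "(\<lambda>n. sqrt n * (\<beta> n - 1)) \<longlonglongrightarrow> 0"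
  shows "weak_conv_m (\<lambda>n. distr M borel (\<lambda>\<omega>. sqrt n * (ek n \<omega> - \<theta>))) (normal_law 0 (4 * F.variance proj))"
proof -
  let ?K = "2 * ((\<integral>z. (p z)\<^sup>2 \<partial>F) + (\<integral>z. (q z)\<^sup>2 \<partial>F))"
  define e where "e n = \<bar>\<alpha> n - 1\<bar> + \<bar>\<gamma> n + 2\<bar> + \<bar>\<beta> n - 1\<bar>" for n
  have e_lim: "(\<lambda>n. sqrt n * e n) \<longlonglongrightarrow> 0"
  proof -
    have "(\<lambda>n. \<bar>sqrt n * (\<alpha> n - 1)\<bar> + \<bar>sqrt n * (\<gamma> n + 2)\<bar> + \<bar>sqrt n * (\<beta> n - 1)\<bar>) \<longlonglongrightarrow> 0 + 0 + 0"
      using \<alpha> \<beta> \<gamma> by (intro tendsto_add tendsto_rabs_zero)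
    moreover have "sqrt n * e n
        = \<bar>sqrt n * (\<alpha> n - 1)\<bar> + \<bar>sqrt n * (\<gamma> n + 2)\<bar> + \<bar>sqrt n * (\<beta> n - 1)\<bar>" for n
      unfolding e_def abs_mult by (simp add: algebra_simps)
    ultimately show ?thesis by simp
  qed
  let ?S = "\<lambda>n \<omega>. (\<Sum>i=1..n. \<Sum>j=1..n. (dist_mat (\<lambda>i. p (Z i \<omega>)) i j)\<^sup>2 + (dist_mat (\<lambda>i. q (Z i \<omega>)) i j)\<^sup>2)
      / (2 * (real n)\<^sup>2)"
  have main: "integrable M (\<lambda>\<omega>. ek n \<omega> - khat n \<omega>)
      \<and> expectation (\<lambda>\<omega>. \<bar>ek n \<omega> - khat n \<omega>\<bar>) \<le> e n * ?K" if n: "n \<ge> 3" for n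
  proof -
    have le: "\<bar>ek n \<omega> - khat n \<omega>\<bar> \<le> e n * ?S n \<omega>" for \<omega>
    proof -
      let ?a = "dist_mat (\<lambda>i. p (Z i \<omega>))" and ?b = "dist_mat (\<lambda>i. q (Z i \<omega>))"
      let ?P = "mean_prod n ?a ?b" and ?Q = "row_mean_prod n ?a ?b"
        and ?G = "grand_mean n ?a * grand_mean n ?b"
      have P: "\<bar>?P\<bar> \<le> ?S n \<omega>" by (rule abs_mean_prod_le)
      have Q: "\<bar>?Q\<bar> \<le> ?S n \<omega>" by (rule order_trans[OF abs_row_mean_prod_le sum_sq_row_mean_le])
      have G: "\<bar>?G\<bar> \<le> ?S n \<omega>" by (rule order_trans[OF abs_grand_mean_prod_le sum_sq_row_mean_le])
      have "ek n \<omega> - khat n \<omega> = 1/4 * ((\<alpha> n - 1) * ?P + (\<gamma> n + 2) * ?Q + (\<beta> n - 1) * ?G)"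
        using n unfolding ek_def by (subst eq, simp, subst kappa_hat_eq, simp) (simp add: algebra_simps)
      then have "\<bar>ek n \<omega> - khat n \<omega>\<bar> \<le> \<bar>(\<alpha> n - 1) * ?P\<bar> + \<bar>(\<gamma> n + 2) * ?Q\<bar> + \<bar>(\<beta> n - 1) * ?G\<bar>"
        by (simp only: abs_quarter_sum_le)
      also have "\<dots> \<le> \<bar>\<alpha> n - 1\<bar> * ?S n \<omega> + \<bar>\<gamma> n + 2\<bar> * ?S n \<omega> + \<bar>\<beta> n - 1\<bar> * ?S n \<omega>"
        using P Q G unfolding abs_mult[of "_ - 1"] abs_mult[of "_ + 2"]
        by (intro add_mono mult_left_mono) auto
      finally show ?thesis by (simp only: e_def distrib_right)
    qed
    have S: "integrable M (?S n)" "expectation (?S n) \<le> ?K"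
      by (rule expectation_sum_sq_dist_le; use n in simp)+
    have e_nonneg: "e n \<ge> 0" by (simp add: e_def)
    have int: "integrable M (\<lambda>\<omega>. ek n \<omega> - khat n \<omega>)"
    proof (rule Bochner_Integration.integrable_bound)
      show "integrable M (\<lambda>\<omega>. e n * ?S n \<omega>)" using S(1) by (rule integrable_mult_right)
      show "AE \<omega> in M. norm (ek n \<omega> - khat n \<omega>) \<le> norm (e n * ?S n \<omega>)"
        unfolding real_norm_def by (rule AE_I2) (rule order_trans[OF le abs_ge_self])
    qed (use meas in measurable)
    have "expectation (\<lambda>\<omega>. \<bar>ek n \<omega> - khat n \<omega>\<bar>) \<le> expectation (\<lambda>\<omega>. e n * ?S n \<omega>)"
      using int S(1) le by (intro integral_mono integrable_mult_right) auto
    also have "\<dots> = e n * expectation (?S n)" by (rule integral_mult_right_zero)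
    also have "\<dots> \<le> e n * ?K" using S(2) e_nonneg by (rule mult_left_mono)
    finally show ?thesis using int by simp
  qed
  show ?thesis
  proof (rule weak_conv_m_sqrt_close[OF measurable_khat meas _ khat_clt main])
    show "real_distribution (normal_law 0 (4 * F.variance proj))"
      by (rule real_distribution_normal_law) simp
    show "(\<lambda>n. sqrt n * (e n * ?K)) \<longlonglongrightarrow> 0"
      using tendsto_mult_right[OF e_lim, of ?K] by (simp add: mult.assoc)
  qed
qed

lemma ktilde_clt:
  "weak_conv_m (\<lambda>n. distr M borel (\<lambda>\<omega>. sqrt n * (ktilde n \<omega> - \<theta>))) (normal_law 0 (4 * F.variance proj))"
proof (rule estimator_clt[OF measurable_ktilde])
  show "kappa_tilde n x y = 1/4 * (real n / (real n - 1) * mean_prod n (dist_mat x) (dist_mat y)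
      + (real n / (real n - 1) * (2 * (real n / (real n - 1))\<^sup>2 - 4 * (real n / (real n - 1)))
          - 4 * (real n / (real n - 1))\<^sup>2 / (real n - 1)) * row_mean_prod n (dist_mat x) (dist_mat y)
      + (real n / (real n - 1) * (2 * (real n / (real n - 1)) - (real n / (real n - 1))\<^sup>2)
          + 3 * (real n / (real n - 1))\<^sup>2 / (real n - 1))
        * (grand_mean n (dist_mat x) * grand_mean n (dist_mat y)))" if "n \<ge> 3" for n x y
    using that by (intro kappa_tilde_eq) simp
qed real_asymp+

lemma kstar_clt:
  "weak_conv_m (\<lambda>n. distr M borel (\<lambda>\<omega>. sqrt n * (kstar n \<omega> - \<theta>))) (normal_law 0 (4 * F.variance proj))"
proof (rule estimator_clt[OF measurable_kstar kappa_star_eq])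
qed (assumption | real_asymp)+

section \<open>The asymptotic variance\<close>

text \<open>The conditional expectation of \<open>\<bar>p (Z 2) - p (Z 1)\<bar> * \<bar>q (Z 2) - q (Z 3)\<bar>\<close> given \<open>p (Z 1) = s\<close>, with
  \<open>Z 3\<close> integrated out already, which turns the second factor into \<open>g_at F2 (q (Z 2))\<close>.\<close>

definition cross :: "real \<Rightarrow> real" where
  "cross s = (\<integral>w. \<bar>s - p w\<bar> * g_at F2 (q w) \<partial>F)"

lemma measurable_cross [measurable]: "cross \<in> borel_measurable borel"
  unfolding cross_def by measurable

lemma cond_exp_cross:
  "AE \<omega> in M. real_cond_exp M (sigma_rv M (\<lambda>\<omega>. p (Z 1 \<omega>)))
      (\<lambda>\<omega>. \<bar>p (Z 2 \<omega>) - p (Z 1 \<omega>)\<bar> * \<bar>q (Z 2 \<omega>) - q (Z 3 \<omega>)\<bar>) \<omega> = cross (p (Z 1 \<omega>))"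
proof -
  let ?A = "sigma_rv M (\<lambda>\<omega>. p (Z 1 \<omega>))"
  let ?f = "\<lambda>\<omega>. \<bar>p (Z 2 \<omega>) - p (Z 1 \<omega>)\<bar> * \<bar>q (Z 2 \<omega>) - q (Z 3 \<omega>)\<bar>"
  let ?k = "\<lambda>\<omega>. \<bar>p (Z 1 \<omega>) - p (Z 2 \<omega>)\<bar> * g_at F2 (q (Z 2 \<omega>))"
  have [measurable]: "Z 1 \<in> measurable M N" "Z 2 \<in> measurable M N" "Z 3 \<in> measurable M N"
    by simp_all
  have pZ [measurable]: "(\<lambda>\<omega>. p (Z 1 \<omega>)) \<in> borel_measurable M" by measurable
  have "subalgebra M ?A"
    unfolding subalgebra_def sigma_rv_def
    by (auto simp: sets_vimage_algebra2 intro!: measurable_sets[OF pZ])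
  then interpret sub: finite_measure_subalgebra M ?A
    by unfold_locales
  have sq12: "integrable M (\<lambda>\<omega>. \<bar>p (Z 1 \<omega>) - p (Z 2 \<omega>)\<bar>\<^sup>2)"
    using X.integrable_dist_sq_pair integral_pair_Z(2)[of 1 2 "\<lambda>w. \<bar>p (fst w) - p (snd w)\<bar>\<^sup>2"] by simp
  have sq23: "integrable M (\<lambda>\<omega>. \<bar>q (Z 2 \<omega>) - q (Z 3 \<omega>)\<bar>\<^sup>2)"
    using Y.integrable_dist_sq_pair integral_pair_Z(2)[of 2 3 "\<lambda>w. \<bar>q (fst w) - q (snd w)\<bar>\<^sup>2"] by simp
  have sqg: "integrable M (\<lambda>\<omega>. (g_at F2 (q (Z 2 \<omega>)))\<^sup>2)"
    using Y.integrable_g_at_L_sq integral_Z(2)[of 2 "\<lambda>w. (g_at F2 (q w))\<^sup>2"] by simp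
  have int_f: "integrable M ?f"
    unfolding abs_minus_commute[of "p (Z 2 _)"]
    by (rule integrable_mult_square_integrable[OF _ _ sq12 sq23]) measurable
  have int_k: "integrable M ?k"
    by (rule integrable_mult_square_integrable[OF _ _ sq12 sqg]) measurable
  have int_k_pair: "integrable (F \<Otimes>\<^sub>M F) (\<lambda>w. \<bar>p (fst w) - p (snd w)\<bar> * g_at F2 (q (snd w)))"
    using int_k integral_pair_Z(2)[of 1 2 "\<lambda>w. \<bar>p (fst w) - p (snd w)\<bar> * g_at F2 (q (snd w))"] by simp
  have int_cross: "integrable M (\<lambda>\<omega>. cross (p (Z 1 \<omega>)))"
    using FF.integrable_fst'[OF int_k_pair] integral_Z(2)[of 1 "\<lambda>z. cross (p z)"]
    by (simp add: cross_def)
  have eq: "(\<integral>\<omega>\<in>A. ?f \<omega> \<partial>M) = (\<integral>\<omega>\<in>A. cross (p (Z 1 \<omega>)) \<partial>M)" if "A \<in> sets ?A" for A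
  proof -
    obtain B where B [measurable]: "B \<in> sets borel" and A: "A = (\<lambda>\<omega>. p (Z 1 \<omega>)) -` B \<inter> space M"
      using \<open>A \<in> sets ?A\<close> unfolding sigma_rv_def by (auto simp: sets_vimage_algebra2)
    let ?b = "\<lambda>\<omega>. indicator B (p (Z 1 \<omega>)) :: real"
    have ind: "(\<integral>\<omega>\<in>A. h \<omega> \<partial>M) = expectation (\<lambda>\<omega>. ?b \<omega> * h \<omega>)" for h :: "'a \<Rightarrow> real"
      unfolding set_lebesgue_integral_def A
      by (intro Bochner_Integration.integral_cong refl) (auto simp: indicator_def)
    have b_int: "integrable M (\<lambda>\<omega>. ?b \<omega> * h \<omega>)" if "integrable M h" for h
      using that by (intro Bochner_Integration.integrable_bound[OF that]) (auto simp: indicator_def)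
    \<comment> \<open>First integrate out the third, then the second observation.\<close>
    have "expectation (\<lambda>\<omega>. (\<lambda>w. indicator B (p (fst w)) * \<bar>p (snd w) - p (fst w)\<bar>) (Z 1 \<omega>, Z 2 \<omega>)
        * (\<lambda>w. \<bar>q (fst w) - q (snd w)\<bar> - g_at F2 (q (fst w))) (Z 2 \<omega>, Z 3 \<omega>)) = 0"
    proof (rule expectation_mult_centred)
      fix z
      have "integrable F (\<lambda>w. \<bar>q z - q w\<bar>)"
        by (rule F.square_integrable_imp_integrable[OF _ Y.integrable_dist_sq]) measurable
      then show "(\<integral>w. \<bar>q (fst (z, w)) - q (snd (z, w))\<bar> - g_at F2 (q (fst (z, w))) \<partial>F) = 0"
        by (simp add: Y.g_at_L)
    qed auto
    then have "expectation (\<lambda>\<omega>. ?b \<omega> * ?f \<omega> - ?b \<omega> * ?k \<omega>) = 0"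
      by (simp add: algebra_simps abs_minus_commute)
    then have 1: "expectation (\<lambda>\<omega>. ?b \<omega> * ?f \<omega>) = expectation (\<lambda>\<omega>. ?b \<omega> * ?k \<omega>)"
      using b_int[OF int_f] b_int[OF int_k] by simp
    have "expectation (\<lambda>\<omega>. (\<lambda>w. indicator B (p (fst w))) (Z 1 \<omega>, Z 1 \<omega>)
        * (\<lambda>w. \<bar>p (fst w) - p (snd w)\<bar> * g_at F2 (q (snd w)) - cross (p (fst w))) (Z 1 \<omega>, Z 2 \<omega>)) = 0"
    proof (rule expectation_mult_centred)
      fix z
      have "integrable F (\<lambda>w. \<bar>p z - p w\<bar> * g_at F2 (q w))"
        by (rule integrable_mult_square_integrable[OF _ _ X.integrable_dist_sq Y.integrable_g_at_L_sq]) measurable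
      then show "(\<integral>w. \<bar>p (fst (z, w)) - p (snd (z, w))\<bar> * g_at F2 (q (snd (z, w)))
          - cross (p (fst (z, w))) \<partial>F) = 0"
        by (simp add: cross_def)
    qed auto
    then have "expectation (\<lambda>\<omega>. ?b \<omega> * ?k \<omega> - ?b \<omega> * cross (p (Z 1 \<omega>))) = 0"
      by (simp add: algebra_simps)
    then have 2: "expectation (\<lambda>\<omega>. ?b \<omega> * ?k \<omega>) = expectation (\<lambda>\<omega>. ?b \<omega> * cross (p (Z 1 \<omega>)))"
      using b_int[OF int_k] b_int[OF int_cross] by simp
    show ?thesis unfolding ind 1 2 ..
  qed
  have "(\<lambda>\<omega>. p (Z 1 \<omega>)) \<in> measurable ?A borel"
    unfolding sigma_rv_def by (rule measurable_vimage_algebra1) simp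
  then have "(\<lambda>\<omega>. cross (p (Z 1 \<omega>))) \<in> borel_measurable ?A"
    by measurable
  from sub.real_cond_exp_charact[OF eq int_f int_cross this] show ?thesis .
qed

end

text \<open>The conditional expectation given the second coordinate is the one above with the coordinates
  interchanged.\<close>

lemma (in iid_pair_sample) iid_pair_sample_swap: "iid_pair_sample M N Z F q p"
  using X.p_sq Y.p_sq pq_sq by unfold_locales (auto simp: mult.commute)

context iid_pair_sample
begin

interpretation swap: iid_pair_sample M N Z F q p
  by (rule iid_pair_sample_swap)

text \<open>Multiplying out \<open>H (z, w)\<close> and integrating over \<open>w\<close> term by term. The last summand does not depend on
  \<open>z\<close>, so it drops out of the variance.\<close>

lemma proj_eq:
  assumes z: "z \<in> space N"
  shows "4 * proj z = (\<integral>w. \<bar>p z - p w\<bar> * \<bar>q z - q w\<bar> \<partial>F) + g_mean F1 * g_at F2 (q z)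
      + g_mean F2 * g_at F1 (p z) - cross (p z) - swap.cross (q z) - g_at F1 (p z) * g_at F2 (q z)
      + ((\<integral>w. g_at F1 (p w) * g_at F2 (q w) \<partial>F) - g_mean F1 * g_mean F2)"
proof -
  let ?a = "\<lambda>w. \<bar>p z - p w\<bar>" and ?b = "\<lambda>w. \<bar>q z - q w\<bar>"
    and ?u = "\<lambda>w. g_at F1 (p w)" and ?v = "\<lambda>w. g_at F2 (q w)"
  let ?k = "g_mean F2 - g_at F2 (q z)" and ?l = "g_mean F1 - g_at F1 (p z)"
  have meas [measurable]: "?a \<in> borel_measurable N" "?b \<in> borel_measurable N"
      "?u \<in> borel_measurable N" "?v \<in> borel_measurable N"
    by measurable
  note sq = X.integrable_dist_sq[of "p z"] Y.integrable_dist_sq[of "q z"] X.integrable_g_at_L_sq Y.integrable_g_at_L_sq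
  have int: "integrable F ?a" "integrable F ?b" "integrable F ?u" "integrable F ?v"
    using sq[THEN F.square_integrable_imp_integrable[rotated]] by auto
  have prods: "integrable F (\<lambda>w. ?a w * ?b w)" "integrable F (\<lambda>w. ?a w * ?v w)"
      "integrable F (\<lambda>w. ?b w * ?u w)" "integrable F (\<lambda>w. ?u w * ?v w)"
    by (intro integrable_mult_square_integrable sq; measurable)+
  have "4 * proj z = (\<integral>w. 4 * H (z, w) \<partial>F)"
    by (simp add: proj_def)
  also have "\<dots> = (\<integral>w. ?a w * ?b w - ?a w * ?v w + ?k * ?a w - ?b w * ?u w + ?u w * ?v w - ?k * ?u w
      + ?l * ?b w - ?l * ?v w + ?l * ?k \<partial>F)"
    by (intro Bochner_Integration.integral_cong refl) (simp add: H_def h_fun_def algebra_simps)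
  also have "\<dots> = (\<integral>w. ?a w * ?b w \<partial>F) - (\<integral>w. ?a w * ?v w \<partial>F) + ?k * (\<integral>w. ?a w \<partial>F)
      - (\<integral>w. ?b w * ?u w \<partial>F) + (\<integral>w. ?u w * ?v w \<partial>F) - ?k * (\<integral>w. ?u w \<partial>F)
      + ?l * (\<integral>w. ?b w \<partial>F) - ?l * (\<integral>w. ?v w \<partial>F) + ?l * ?k"
    using int prods by simp
  also have "\<dots> = (\<integral>w. ?a w * ?b w \<partial>F) - cross (p z) + ?k * g_at F1 (p z)
      - swap.cross (q z) + (\<integral>w. ?u w * ?v w \<partial>F) - ?k * g_mean F1
      + ?l * g_at F2 (q z) - ?l * g_mean F2 + ?l * ?k"
    by (simp add: cross_def swap.cross_def X.g_at_L[of "p z"] Y.g_at_L[of "q z"] X.g_mean_L Y.g_mean_L)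
  finally show ?thesis by (simp add: algebra_simps)
qed

lemma asymptotic_variance:
  defines "W \<equiv> \<lambda>\<omega>. (\<integral>w. \<bar>p (Z 1 \<omega>) - p w\<bar> * \<bar>q (Z 1 \<omega>) - q w\<bar> \<partial>F) + g_mean F1 * g_at F2 (q (Z 1 \<omega>))
      + g_mean F2 * g_at F1 (p (Z 1 \<omega>))
      - real_cond_exp M (sigma_rv M (\<lambda>\<omega>. p (Z 1 \<omega>)))
          (\<lambda>\<omega>. \<bar>p (Z 2 \<omega>) - p (Z 1 \<omega>)\<bar> * \<bar>q (Z 2 \<omega>) - q (Z 3 \<omega>)\<bar>) \<omega>
      - real_cond_exp M (sigma_rv M (\<lambda>\<omega>. q (Z 1 \<omega>)))
          (\<lambda>\<omega>. \<bar>p (Z 2 \<omega>) - p (Z 3 \<omega>)\<bar> * \<bar>q (Z 2 \<omega>) - q (Z 1 \<omega>)\<bar>) \<omega>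
      - g_at F1 (p (Z 1 \<omega>)) * g_at F2 (q (Z 1 \<omega>))"
  shows "1/4 * variance W = 4 * F.variance proj"
proof -
  let ?c = "(\<integral>w. g_at F1 (p w) * g_at F2 (q w) \<partial>F) - g_mean F1 * g_mean F2"
  have Z1 [measurable]: "Z 1 \<in> measurable M N" by simp
  have proj_meas [measurable]: "proj \<in> borel_measurable N"
    unfolding proj_def by measurable
  have sq: "integrable F (\<lambda>z. (proj z)\<^sup>2)"
    unfolding proj_def by (rule integrable_projection_sq[OF measurable_H integrable_H_section integrable_H_sq])
  have int: "integrable F proj"
    by (rule F.square_integrable_imp_integrable[OF _ sq]) measurable
  have W: "AE \<omega> in M. W \<omega> = 4 * proj (Z 1 \<omega>) - ?c"
    using cond_exp_cross swap.cond_exp_cross AE_space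
  proof eventually_elim
    case (elim \<omega>)
    then have "Z 1 \<omega> \<in> space N" using measurable_space[OF Z1] by auto
    then show ?case
      using elim unfolding W_def by (simp add: proj_eq mult.commute[of "\<bar>p (Z 2 _) - _\<bar>"])
  qed
  have W_meas: "W \<in> borel_measurable M"
    unfolding W_def by measurable
  have int1: "integrable M (\<lambda>\<omega>. proj (Z 1 \<omega>))"
    using integral_Z(2)[of 1 proj] int by simp
  have "expectation W = expectation (\<lambda>\<omega>. 4 * proj (Z 1 \<omega>) - ?c)"
    using W W_meas by (intro integral_cong_AE) auto
  also have "\<dots> = 4 * F.expectation proj - ?c"
    using integral_Z(1)[of 1 proj] int1 by (simp add: prob_space)
  finally have EW: "expectation W = 4 * F.expectation proj - ?c" .
  have "variance W = expectation (\<lambda>\<omega>. 16 * (proj (Z 1 \<omega>) - F.expectation proj)\<^sup>2)"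
  proof (rule integral_cong_AE)
    show "AE \<omega> in M. (W \<omega> - expectation W)\<^sup>2 = 16 * (proj (Z 1 \<omega>) - F.expectation proj)\<^sup>2"
      using W
    proof eventually_elim
      case (elim \<omega>)
      then have "W \<omega> - expectation W = 4 * (proj (Z 1 \<omega>) - F.expectation proj)"
        by (simp add: EW)
      then show ?case by (simp only: power_mult_distrib) simp
    qed
  qed (use W_meas in measurable)
  also have "\<dots> = 16 * F.variance proj"
    using integral_Z(1)[of 1 "\<lambda>z. (proj z - F.expectation proj)\<^sup>2"] by simp
  finally show ?thesis by simp
qed

end

section \<open>Asymptotic normality of the three estimators\<close>

theorem theorem3:
  fixes M :: "'a measure"
    and X Y :: "nat \<Rightarrow> 'a \<Rightarrow> real"
    and F12 :: "(real \<times> real) measure"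
    and F1 F2 :: "real measure"
    and \<mu>1 \<mu>2 \<kappa> \<delta>1 :: real
  assumes "prob_space M"
    and "prob_space.indep_vars M (\<lambda>_. borel) (\<lambda>i \<omega>. (X i \<omega>, Y i \<omega>)) {1..}"
    and "\<And>i. i \<ge> 1 \<Longrightarrow> distr M borel (\<lambda>\<omega>. (X i \<omega>, Y i \<omega>)) = F12"
    and "F1 = marginal1 F12"
    and "F2 = marginal2 F12"
    and "integrable M (\<lambda>\<omega>. (X 1 \<omega>)\<^sup>2)"
    and "integrable M (\<lambda>\<omega>. (Y 1 \<omega>)\<^sup>2)"
    and "integrable M (\<lambda>\<omega>. (X 1 \<omega>)\<^sup>2 * (Y 1 \<omega>)\<^sup>2)"
    and "\<mu>1 = g_mean F1"
    and "\<mu>2 = g_mean F2"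
    and "\<kappa> = bergsma_cov F12"
    and "\<delta>1 = 1/4 * prob_space.variance M (\<lambda>\<omega>.
           g_joint F12 (X 1 \<omega>) (Y 1 \<omega>) + \<mu>1 * g_at F2 (Y 1 \<omega>) + \<mu>2 * g_at F1 (X 1 \<omega>)
           - real_cond_exp M (sigma_rv M (X 1)) (\<lambda>\<omega>'. \<bar>X 2 \<omega>' - X 1 \<omega>'\<bar> * \<bar>Y 2 \<omega>' - Y 3 \<omega>'\<bar>) \<omega>
           - real_cond_exp M (sigma_rv M (Y 1)) (\<lambda>\<omega>'. \<bar>X 2 \<omega>' - X 3 \<omega>'\<bar> * \<bar>Y 2 \<omega>' - Y 1 \<omega>'\<bar>) \<omega>
           - g_at F1 (X 1 \<omega>) * g_at F2 (Y 1 \<omega>))"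
  shows "weak_conv_m
           (\<lambda>n. distr M borel (\<lambda>\<omega>. sqrt (real n) * (kappa_star n (\<lambda>i. X i \<omega>) (\<lambda>i. Y i \<omega>) - \<kappa>)))
           (normal_law 0 \<delta>1)
       \<and> weak_conv_m
           (\<lambda>n. distr M borel (\<lambda>\<omega>. sqrt (real n) * (kappa_tilde n (\<lambda>i. X i \<omega>) (\<lambda>i. Y i \<omega>) - \<kappa>)))
           (normal_law 0 \<delta>1)
       \<and> weak_conv_m
           (\<lambda>n. distr M borel (\<lambda>\<omega>. sqrt (real n) * (kappa_hat n (\<lambda>i. X i \<omega>) (\<lambda>i. Y i \<omega>) - \<kappa>)))
           (normal_law 0 \<delta>1)"
proof -
  let ?Z = "\<lambda>i \<omega>. (X i \<omega>, Y i \<omega>)"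
  interpret iid_sample M borel ?Z F12
    using assms(1-3) by (simp add: iid_sample_def iid_sample_axioms_def)
  interpret iid_pair_sample M borel ?Z F12 fst snd
  proof
    show "fst \<in> borel_measurable (borel :: (real \<times> real) measure)"
      "snd \<in> borel_measurable (borel :: (real \<times> real) measure)"
      by (simp_all add: borel_prod[symmetric])
    then show "integrable F12 (\<lambda>z. (fst z)\<^sup>2)" "integrable F12 (\<lambda>z. (snd z)\<^sup>2)"
      "integrable F12 (\<lambda>z. (fst z)\<^sup>2 * (snd z)\<^sup>2)"
      using assms(6-8) integral_Z(2)[of 1 "\<lambda>z. (fst z)\<^sup>2"] integral_Z(2)[of 1 "\<lambda>z. (snd z)\<^sup>2"]
        integral_Z(2)[of 1 "\<lambda>z. (fst z)\<^sup>2 * (snd z)\<^sup>2"]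
      by simp_all
  qed
  have F1: "distr F12 borel fst = F1" and F2: "distr F12 borel snd = F2"
    by (simp_all add: assms(4,5) marginal1_def marginal2_def)
  have \<kappa>: "\<theta> = \<kappa>"
    by (simp add: \<theta>_def H_def[abs_def] F1 F2 assms(11) bergsma_cov_def case_prod_unfold
        flip: assms(4,5))
  have \<delta>: "4 * F.variance proj = \<delta>1"
    using asymptotic_variance
    by (simp add: F1 F2 assms(9,10,12) g_joint_def case_prod_unfold)
  show ?thesis
    using kstar_clt ktilde_clt khat_clt by (simp add: \<kappa> \<delta>)
qed

end
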